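(* In the setting described in the context, suppose $(T_{\lambda,\sigma})$ has an anomaly of second order. Suppose that $\hat\theta\in S^1_\pi$ is a zero of order $4$ of $\mathbf E(p_{1,\sigma}^2)$ and a zero of order $1$ of $\mathbf E(p_{K,\sigma})$, and that $\mathbf E(\partial_\theta p_{K,\sigma}(\hat\theta))<0$. Let $\tilde K>K$ be the index of the first $k>K$ with $\mathbf E(P_{\eta_k,\sigma})\neq0$ and $\tilde\eta=\min\{\eta_{\tilde K},\eta_1+\eta_2\}$. Then for every $f\in C^2(S^1_\pi)$, $$I_N(f)=f(\hat\theta)+\mathcal O\big(\lambda^{\tilde\eta-\eta_K},(\lambda^{\eta_K}N)^{-1}\big),$$ where the error is bounded by a constant (independent of $N$) times $\lambda^{\tilde\eta-\eta_K}+(\lambda^{\eta_K}N)^{-1}$ for small $\lambda>0$.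
   Context: Let $(\Sigma,\mathbf p)$ be a probability space and $(T_{\lambda,\sigma})$ a family in $SL(2,\mathbb R)$ (compactly supported for small $\lambda$, with $\lambda$-dependence a power series with nonnegative exponents) such that for a fixed $M\in SL(2,\mathbb R)$: $MT_{\lambda,\sigma}M^{-1}=\pm\exp\big(\sum_{k\ge1}\lambda^{\eta_k}P_{\eta_k,\sigma}\big)$, $P_{\eta_k,\sigma}\in sl(2,\mathbb R)$, $0<\eta_1<\eta_2<\cdots$, with an index $K$ such that $\eta_K=2\eta_1$, $\eta_{K+1}\le\eta_1+\eta_2$, and $\mathbf p(P_{\eta_k,\sigma}=0)<1$ for $k<K$. Second order anomaly: $\mathbf E(P_{\eta_k,\sigma})=0$ for $k=1,\ldots,K-1$. For $P_{\eta_k,\sigma}=\begin{pmatrix}a&b\\c&-a\end{pmatrix}$ put $p_{k,\sigma}(\theta)=c\cos^2\theta-b\sin^2\theta-a\sin(2\theta)$ on $S^1_\pi=\mathbb R/\pi\mathbb Z$; $\mathbf E$ is expectation. For $T\in SL(2,\mathbb R)$, $\mathcal S_T$ on $S^1_\pi$ is defined by $e_{\mathcal S_T(\theta)}=\pm Te_\theta/\|Te_\theta\|$, $e_\theta=(\cos\theta,\sin\theta)^T$; $\mathcal S_{\lambda,\sigma}=\mathcal S_{MT_{\lambda,\sigma}M^{-1}}$; with $(\sigma_n)$ i.i.d. of law $\mathbf p$ and $\theta_0\in S^1_\pi$, $\theta_{n+1}=\mathcal S_{\lambda,\sigma_{n+1}}(\theta_n)$, and $I_N(f)=\frac1N\mathbf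 E\sum_{n=0}^{N-1}f(\theta_n)$. *)

theory Defs
  imports "HOL-Analysis.Analysis" "HOL-Probability.Probability"
begin

type_synonym mat2 = "real^2^2"

text \<open>Matrix powers and matrix exponential for 2x2 real matrices
(the type real^2^2 carries a componentwise ring structure, so the library's
exp would be the componentwise exponential; we define the matrix one).\<close>
primrec mpow :: "mat2 \<Rightarrow> nat \<Rightarrow> mat2" where
  "mpow A 0 = mat 1"
| "mpow A (Suc n) = A ** mpow A n"

definition mexp :: "mat2 \<Rightarrow> mat2" where
  "mexp A = (\<Sum>n. (1 / fact n) *\<^sub>R mpow A n)"

definition sl2 :: "mat2 \<Rightarrow> bool" where
  "sl2 A \<longleftrightarrow> A$1$1 + A$2$2 = 0"

definition evec :: "real \<Rightarrow> real^2" where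
  "evec \<theta> = vector [cos \<theta>, sin \<theta>]"

text \<open>Angle map on S^1_pi = R/pi Z, represented by the angle in [0,pi).\<close>
definition angle_map :: "mat2 \<Rightarrow> real \<Rightarrow> real" where
  "angle_map T \<theta> = (let v = (1 / norm (T *v evec \<theta>)) *\<^sub>R (T *v evec \<theta>) in
     (THE \<phi>. 0 \<le> \<phi> \<and> \<phi> < pi \<and> (evec \<phi> = v \<or> evec \<phi> = - v)))"

definition pfun :: "mat2 \<Rightarrow> real \<Rightarrow> real" where
  "pfun P \<theta> = P$2$1 * (cos \<theta>)^2 - P$1$2 * (sin \<theta>)^2 - P$1$1 * sin (2*\<theta>)"

text \<open>Random orbit: theta_{n+1} = S_{sigma_{n+1}}(theta_n), with sigma_{n+1} = omega n.\<close>
primrec orbit :: "('s \<Rightarrow> real \<Rightarrow> real) \<Rightarrow> real \<Rightarrow> (nat \<Rightarrow> 's) \<Rightarrow> nat \<Rightarrow> real" where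
  "orbit S \<theta>0 \<omega> 0 = \<theta>0"
| "orbit S \<theta>0 \<omega> (Suc n) = S (\<omega> n) (orbit S \<theta>0 \<omega> n)"

definition I_N :: "'s measure \<Rightarrow> ('s \<Rightarrow> real \<Rightarrow> real) \<Rightarrow> real \<Rightarrow> nat \<Rightarrow> (real \<Rightarrow> real) \<Rightarrow> real" where
  "I_N p S \<theta>0 N f = (1 / real N) *
     (\<integral>\<omega>. (\<Sum>n<N. f (orbit S \<theta>0 \<omega> n)) \<partial>(PiM UNIV (\<lambda>_::nat. p)))"

definition zero_of_order :: "(real \<Rightarrow> real) \<Rightarrow> real \<Rightarrow> nat \<Rightarrow> bool" where
  "zero_of_order g x n \<longleftrightarrow> (\<forall>j<n. (deriv ^^ j) g x = 0) \<and> (deriv ^^ n) g x \<noteq> 0"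

definition C2_periodic :: "(real \<Rightarrow> real) \<Rightarrow> bool" where
  "C2_periodic f \<longleftrightarrow> (\<forall>x. f (x + pi) = f x) \<and>
     (\<exists>f' f''. (\<forall>x. (f has_real_derivative f' x) (at x) \<and> (f' has_real_derivative f'' x) (at x))
              \<and> continuous_on UNIV f'')"

end

theory Submission
  imports Defs "HOL-Library.Periodic_Fun"
begin

text \<open>
  A $2\times 2$ matrix acts on the line through $z$ in the complex plane, and the line is recorded by
  $\zeta = z / \bar z$, which does not change when $z$ is rescaled; if the matrix moves $z$ to
  $z(1 + a)$, then $\zeta$ moves to $\zeta(1+a)/(1+\bar a)$, and this is expanded to second order in $a$.

  A zero of order four of $\mathbf E(p_1^2)$ means that almost surely $P_1$ is nilpotent with kernel
  spanned by $e_{\hat\theta}$. A shear that keeps this direction makes $\mathbf E(P_K)$ equal to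
  $\mathrm{diag}(A,-A)$ with $A > 0$, and a dilation adjusts the variance of the only entry of $P_1$ to $A/2$. In these
  coordinates the expected increment of $\zeta$ is $\lambda^{\eta_K} D(\zeta)$ with
  $D(\zeta) = A(1-\zeta^2) + \frac A4 (1 - \mathrm{Re}\,\zeta)\,\zeta(\zeta-1)$, up to an error of order
  $\lambda^{\tilde\eta}$. Telescoping shows that the Birkhoff average of $D$ is of the size of the
  claimed error. Since $\mathrm{Re}\,D \ge \frac A2(1 - \mathrm{Re}\,\zeta)$ is a Lyapunov bound, and
  $\mathrm{Im}\,D = -2A\,\mathrm{Im}\,\zeta$ up to a multiple of $1 - \mathrm{Re}\,\zeta$, a function $f$ of class
  $C^2$ satisfies $|f - f(\hat\theta) + c\,\mathrm{Im}\,D| \le c'\,\mathrm{Re}\,D$ for suitable constants. So no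
  Poisson equation for the degenerate generator has to be solved.
\<close>

section \<open>The matrix exponential\<close>

text \<open>Angles are awkward to iterate: \<open>angle_map\<close> is a definite description, the
  matrices are known only up to sign, and measurability is known for the \<open>P k\<close>. The
  dynamics is therefore lifted to the exponentials acting linearly on the plane. That action is
  jointly measurable, and the sign does not change the line, which is all that f sees. The
  deterministic part A(1 - \<zeta>^2) of D also vanishes at \<zeta> = -1, the repelling direction,
  and there only the noise moves the orbit. Near \<zeta> = 1 the noise works against the
  contraction. A dilation rescales the entry of \<open>P 1\<close> and leaves A alone, so the
  balance can be chosen such that Re D > 0 off \<zeta> = 1. On the circle Re D has a double zero at
  \<zeta> = 1 and Im D a simple one. Hence Im D absorbs the linear term of f at the fixed direction
  and Re D the quadratic remainder; this is where C^2 enters. The local error has three sources: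
  products of \<open>P 1\<close> with later terms (exponent \<eta>_1 + \<eta>_2), cubic terms (3
  \<eta>_1, no smaller because \<eta>_2 \<le> \<eta>_K = 2 \<eta>_1), and the first nonzero mean
  beyond \<open>P K\<close>.\<close>

lemma matrix_mult_add_rdistrib: "(A + B) ** C = A ** C + B ** (C :: 'a::semiring_1^'n^'m)"
  by (simp add: matrix_matrix_mult_def vec_eq_iff sum.distrib distrib_right)

lemma norm_matrix_vector_le:
  fixes A :: "real^'n^'m"
  shows "norm (A *v x) \<le> norm A * norm x"
proof -
  have "norm (A *v x) = L2_set (\<lambda>i. norm ((A *v x) $ i)) UNIV"
    by (simp add: norm_vec_def)
  also have "\<dots> \<le> L2_set (\<lambda>i. norm (A $ i) * norm x) UNIV"
    by (intro L2_set_mono) (auto simp: matrix_vector_mul_component Cauchy_Schwarz_ineq2)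
  also have "\<dots> = norm A * norm x"
    by (simp add: L2_set_left_distrib norm_vec_def)
  finally show ?thesis .
qed

lemma norm_matrix_transpose:
  fixes A :: "real^'n^'m"
  shows "norm (transpose A) = norm A"
proof -
  have "(norm (transpose A))\<^sup>2 = (norm A)\<^sup>2"
    unfolding power2_norm_eq_inner inner_vec_def transpose_def
    by (simp, subst sum.swap, simp)
  then show ?thesis by simp
qed

text \<open>The norm is the Euclidean norm of all entries. Row i of a product is the transposed
  right factor applied to row i of the left one, and transposition preserves this norm.\<close>

lemma norm_matrix_mult_le:
  fixes A :: "real^'n^'m" and B :: "real^'k^'n"
  shows "norm (A ** B) \<le> norm A * norm B"
proof -
  have row: "(A ** B) $ i = transpose B *v A $ i" for i
    by (simp add: matrix_matrix_mult_def matrix_vector_mult_def transpose_def vec_eq_iff mult.commute)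
  have "norm (A ** B) = L2_set (\<lambda>i. norm ((A ** B) $ i)) UNIV"
    by (simp add: norm_vec_def)
  also have "\<dots> \<le> L2_set (\<lambda>i. norm (A $ i) * norm B) UNIV"
    using norm_matrix_vector_le[of "transpose B"]
    by (intro L2_set_mono) (auto simp: row norm_matrix_transpose mult.commute[of "norm B"])
  also have "\<dots> = norm A * norm B"
    by (simp add: L2_set_left_distrib norm_vec_def)
  finally show ?thesis .
qed

text \<open>In this norm the identity has norm sqrt 2 instead of 1; the factor 2 in the bounds for
  powers starts here.\<close>

lemma norm_mat_1_le: "norm (mat 1 :: mat2) \<le> 2"
  by (simp add: norm_vec_def L2_set_def sum_2 mat_def real_le_lsqrt)

lemma norm_mpow_le: "norm (mpow A n) \<le> 2 * norm A ^ n"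
proof (induction n)
  case 0 show ?case using norm_mat_1_le by simp
next
  case (Suc n)
  have "norm (mpow A (Suc n)) \<le> norm A * norm (mpow A n)"
    by (simp add: norm_matrix_mult_le)
  also have "\<dots> \<le> norm A * (2 * norm A ^ n)"
    by (intro mult_left_mono Suc) auto
  finally show ?case by (simp add: mult_ac)
qed

lemma norm_mexp_term_le: "norm ((1 / fact n) *\<^sub>R mpow A n) \<le> 2 * (norm A ^ n / fact n)"
  using mult_left_mono[OF norm_mpow_le[of A n], of "1 / fact n"]
  by (simp add: mult_ac field_simps)

lemma summable_exp_real: "summable (\<lambda>n. (x::real) ^ n / fact n)"
  using summable_exp_generic[of x] by (simp add: field_simps)

lemma summable_mexp: "summable (\<lambda>n. (1 / fact n) *\<^sub>R mpow A n)"
  by (rule summable_comparison_test'[OF summable_mult[OF summable_exp_real, of 2], of 0 _ "norm A"])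
     (rule norm_mexp_term_le)

text \<open>Because \<open>fact (n + 3) \<ge> fact n\<close>, the tail is at most 2 |A|^3 exp |A|,
  and exp 1 \<le> 3 gives the constant 6.\<close>

lemma norm_mexp_remainder_le:
  assumes "norm A \<le> 1"
  shows "norm (mexp A - (mat 1 + A + (1/2) *\<^sub>R (A ** A))) \<le> 6 * norm A ^ 3"
proof -
  let ?t = "\<lambda>n. (1 / fact n) *\<^sub>R mpow A n"
  let ?x = "norm A"
  have head: "(\<Sum>n<3. ?t n) = mat 1 + A + (1/2) *\<^sub>R (A ** A)"
    by (simp add: numeral_3_eq_3 numeral_2_eq_2)
  have "mexp A - (\<Sum>n<3. ?t n) = (\<Sum>n. ?t (n + 3))"
    unfolding mexp_def using suminf_split_initial_segment[OF summable_mexp, of A 3] by simp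
  also have "norm \<dots> \<le> (\<Sum>n. 2 * (?x ^ 3 * (?x ^ n / fact n)))"
  proof (rule norm_suminf_le)
    show "summable (\<lambda>n. 2 * (?x ^ 3 * (?x ^ n / fact n)))"
      by (intro summable_mult summable_exp_real)
    fix n
    have "norm (?t (n + 3)) \<le> 2 * (?x ^ (n + 3) / fact (n + 3))" by (rule norm_mexp_term_le)
    also have "\<dots> \<le> 2 * (?x ^ (n + 3) / fact n)"
      by (intro mult_left_mono divide_left_mono fact_mono) auto
    finally show "norm (?t (n + 3)) \<le> 2 * (?x ^ 3 * (?x ^ n / fact n))"
      by (simp add: power_add mult_ac)
  qed
  also have "\<dots> = 2 * (?x ^ 3 * exp ?x)"
    using summable_exp_real[of ?x]
    by (simp add: suminf_mult summable_mult exp_def divide_inverse mult.commute)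
  also have "\<dots> \<le> 2 * (?x ^ 3 * 3)"
    using assms exp_le by (intro mult_left_mono) (auto intro: order_trans[of _ "exp 1"])
  finally show ?thesis by (simp add: head)
qed

lemma mexp_measurable [measurable]: "mexp \<in> borel_measurable borel"
proof -
  have "continuous_on UNIV (\<lambda>A. mpow A n)" for n
  proof (induction n)
    case (Suc n)
    then show ?case
      unfolding mpow.simps matrix_matrix_mult_def by (intro continuous_intros)
  qed simp
  then have [measurable]: "(\<lambda>A. mpow A n) \<in> borel_measurable borel" for n
    by (rule borel_measurable_continuous_onI)
  show ?thesis unfolding mexp_def[abs_def] by measurable
qed

section \<open>Averages along random orbits\<close>

text \<open>Counterpart of \<open>orbit\<close> on an arbitrary state space; it will be run on
  vectors of the plane.\<close>

primrec path :: "('s \<Rightarrow> 'x \<Rightarrow> 'x) \<Rightarrow> 'x \<Rightarrow> (nat \<Rightarrow> 's) \<Rightarrow> nat \<Rightarrow> 'x" where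
  "path S x \<omega> 0 = x"
| "path S x \<omega> (Suc n) = S (\<omega> n) (path S x \<omega> n)"

lemma path_case_nat: "path S x (case_nat s \<omega>) (Suc n) = path S (S s x) \<omega> n"
  by (induction n) simp_all

text \<open>A non-integrable g is covered as well: its integral is 0 by default, hence the condition
  \<open>d \<ge> 0\<close>.\<close>

lemma (in prob_space) norm_integral_le_const:
  fixes g :: "'a \<Rightarrow> 'b::{banach,second_countable_topology}"
  assumes "AE x in M. norm (g x) \<le> d" "d \<ge> 0"
  shows "norm (\<integral>x. g x \<partial>M) \<le> d"
proof (cases "integrable M g")
  case True
  have "norm (\<integral>x. g x \<partial>M) \<le> (\<integral>x. norm (g x) \<partial>M)"
    by (rule integral_norm_bound)
  also have "\<dots> \<le> (\<integral>x. d \<partial>M)"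
    by (rule integral_mono_AE) (use True assms(1) in simp_all)
  finally show ?thesis by (simp add: prob_space)
qed (simp add: not_integrable_integral_eq assms(2))

locale random_dynamics = prob_space p for p :: "'s measure" +
  fixes S :: "'s \<Rightarrow> 'x::{second_countable_topology,t2_space} \<Rightarrow> 'x"
  assumes step_measurable [measurable]: "(\<lambda>(s, x). S s x) \<in> p \<Otimes>\<^sub>M borel \<rightarrow>\<^sub>M borel"
begin

abbreviation \<Omega> :: "(nat \<Rightarrow> 's) measure" where
  "\<Omega> \<equiv> PiM UNIV (\<lambda>_. p)"

text \<open>Transition operator of the chain. It acts on Banach valued functions so that the complex
  coordinate of a line can be inserted directly.\<close>

definition markov :: "('x \<Rightarrow> 'b::{banach,second_countable_topology}) \<Rightarrow> 'x \<Rightarrow> 'b" where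
  "markov g x = (\<integral>s. g (S s x) \<partial>p)"

interpretation seq: sequence_space p
  by unfold_locales

text \<open>Joint measurability in the starting point is what Fubini asks for once the first step
  has made the start random.\<close>

lemma path_measurable:
  "(\<lambda>(x, \<omega>). path S x \<omega> n) \<in> borel \<Otimes>\<^sub>M \<Omega> \<rightarrow>\<^sub>M borel"
proof (induction n)
  case (Suc n)
  note Suc [measurable]
  have "(\<lambda>z. (\<lambda>(s, x). S s x) (snd z n, (\<lambda>(x, \<omega>). path S x \<omega> n) z)) \<in> borel \<Otimes>\<^sub>M \<Omega> \<rightarrow>\<^sub>M borel"
    by measurable
  then show ?case by (simp add: case_prod_beta')
qed (simp add: case_prod_beta')

lemma path_measurable_snd [measurable]: "(\<lambda>\<omega>. path S x \<omega> n) \<in> \<Omega> \<rightarrow>\<^sub>M borel"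
  using measurable_compose[OF _ path_measurable, of "\<lambda>\<omega>. (x, \<omega>)"] by simp

lemma integrable_path:
  fixes g :: "'x \<Rightarrow> 'b::{banach,second_countable_topology}"
  assumes [measurable]: "g \<in> borel_measurable borel" and "\<And>x. norm (g x) \<le> B"
  shows "integrable \<Omega> (\<lambda>\<omega>. g (path S x \<omega> n))"
  by (rule seq.P.integrable_const_bound[of _ B]) (use assms(2) in auto)

lemma markov_measurable:
  fixes g :: "'x \<Rightarrow> 'b::{banach,second_countable_topology}"
  assumes [measurable]: "g \<in> borel_measurable borel"
  shows "markov g \<in> borel_measurable borel"
proof -
  have "(\<lambda>(x, s). g ((\<lambda>(s, x). S s x) (s, x))) \<in> borel_measurable (borel \<Otimes>\<^sub>M p)"
    by measurable
  then show ?thesis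
    unfolding markov_def[abs_def]
    by (intro sigma_finite_measure.borel_measurable_lebesgue_integral sigma_finite_measure_axioms) simp
qed

lemma norm_markov_le:
  fixes g :: "'x \<Rightarrow> 'b::{banach,second_countable_topology}"
  assumes [measurable]: "g \<in> borel_measurable borel" and g: "\<And>x. norm (g x) \<le> B"
  shows "norm (markov g x) \<le> B"
proof -
  have "0 \<le> B" using norm_ge_zero g by (rule order_trans)
  then show ?thesis
    unfolding markov_def by (intro norm_integral_le_const) (simp_all add: g)
qed

text \<open>Prepending an independent coordinate to an i.i.d. sequence reproduces its law; Fubini
  then isolates the first step.\<close>

lemma integral_path_front:
  fixes g :: "'x \<Rightarrow> 'b::{banach,second_countable_topology}"
  assumes [measurable]: "g \<in> borel_measurable borel" and g: "\<And>x. norm (g x) \<le> B"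
  shows "(\<integral>\<omega>. g (path S x \<omega> (Suc n)) \<partial>\<Omega>) = (\<integral>s. \<integral>\<omega>. g (path S (S s x) \<omega> n) \<partial>\<Omega> \<partial>p)"
proof -
  interpret F: pair_prob_space p \<Omega> by unfold_locales
  have m: "(\<lambda>(s, \<omega>). case_nat s \<omega>) \<in> p \<Otimes>\<^sub>M \<Omega> \<rightarrow>\<^sub>M \<Omega>"
    by measurable
  have "(\<integral>\<omega>. g (path S x \<omega> (Suc n)) \<partial>\<Omega>)
      = (\<integral>\<omega>. g (path S x \<omega> (Suc n)) \<partial>(distr (p \<Otimes>\<^sub>M \<Omega>) \<Omega> (\<lambda>(s, \<omega>). case_nat s \<omega>)))"
    by (simp only: seq.PiM_iter)
  also have "\<dots> = (\<integral>z. g (path S x (case_nat (fst z) (snd z)) (Suc n)) \<partial>(p \<Otimes>\<^sub>M \<Omega>))"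
    by (subst integral_distr[OF m]) (simp_all add: case_prod_beta' del: path.simps)
  also have "\<dots> = (\<integral>(s, \<omega>). g (path S (S s x) \<omega> n) \<partial>(p \<Otimes>\<^sub>M \<Omega>))"
    by (simp add: path_case_nat case_prod_beta' del: path.simps)
  also have "\<dots> = (\<integral>s. \<integral>\<omega>. g (path S (S s x) \<omega> n) \<partial>\<Omega> \<partial>p)"
  proof (rule F.integral_fst[symmetric])
    note path_measurable[measurable]
    have "(\<lambda>z. g ((\<lambda>(x, \<omega>). path S x \<omega> n) (S (fst z) x, snd z))) \<in> borel_measurable (p \<Otimes>\<^sub>M \<Omega>)"
      by measurable
    then have "(\<lambda>(s, \<omega>). g (path S (S s x) \<omega> n)) \<in> borel_measurable (p \<Otimes>\<^sub>M \<Omega>)"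
      by (simp add: case_prod_beta')
    then show "integrable (p \<Otimes>\<^sub>M \<Omega>) (\<lambda>(s, \<omega>). g (path S (S s x) \<omega> n))"
      by (rule F.P.integrable_const_bound[rotated, of _ B]) (use g in auto)
  qed
  finally show ?thesis .
qed

text \<open>The operator \<open>markov\<close> acts on the last step, whereas
  \<open>integral_path_front\<close> peels off the first. Induction with a variable start carries
  the statement from the front to the end, so no conditional expectations are involved.\<close>

lemma integral_path_Suc:
  fixes g :: "'x \<Rightarrow> 'b::{banach,second_countable_topology}"
  assumes [measurable]: "g \<in> borel_measurable borel" and g: "\<And>x. norm (g x) \<le> B"
  shows "(\<integral>\<omega>. g (path S x \<omega> (Suc n)) \<partial>\<Omega>) = (\<integral>\<omega>. markov g (path S x \<omega> n) \<partial>\<Omega>)"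
proof (induction n arbitrary: x)
  case 0
  show ?case
    using integral_path_front[OF assms, of x 0] by (simp add: markov_def seq.P.prob_space)
next
  case (Suc n)
  have "(\<integral>\<omega>. g (path S x \<omega> (Suc (Suc n))) \<partial>\<Omega>) = (\<integral>s. \<integral>\<omega>. g (path S (S s x) \<omega> (Suc n)) \<partial>\<Omega> \<partial>p)"
    by (rule integral_path_front[OF assms])
  also have "\<dots> = (\<integral>s. \<integral>\<omega>. markov g (path S (S s x) \<omega> n) \<partial>\<Omega> \<partial>p)"
    by (simp only: Suc)
  also have "\<dots> = (\<integral>\<omega>. markov g (path S x \<omega> (Suc n)) \<partial>\<Omega>)"
    by (rule integral_path_front[symmetric, OF markov_measurable norm_markov_le, OF assms(1) assms])
  finally show ?case .
qed

definition average :: "'x \<Rightarrow> nat \<Rightarrow> ('x \<Rightarrow> 'b::{banach,second_countable_topology}) \<Rightarrow> 'b" where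
  "average x N g = (1 / real N) *\<^sub>R (\<integral>\<omega>. (\<Sum>n<N. g (path S x \<omega> n)) \<partial>\<Omega>)"

text \<open>The increments of the expectation of G telescope to boundary terms of size 2B, and each
  equals e times the expectation of D up to d. Division by e N yields the two summands: the
  accumulated local error and the boundary.\<close>

lemma average_generator:
  fixes G D :: "'x \<Rightarrow> 'b::{banach,second_countable_topology}"
  assumes G [measurable]: "G \<in> borel_measurable borel" "\<And>x. norm (G x) \<le> B"
    and D [measurable]: "D \<in> borel_measurable borel" "\<And>x. norm (D x) \<le> B'"
    and gen: "\<And>x. norm (markov G x - G x - e *\<^sub>R D x) \<le> d"
    and "e > 0" "N \<ge> 1"
  shows "norm (average x N D) \<le> d / e + 2 * B / (e * real N)"
proof -
  let ?A = "\<lambda>g n. \<integral>\<omega>. g (path S x \<omega> n) \<partial>\<Omega>"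
  note int = integrable_path[OF G] integrable_path[OF D]
    integrable_path[OF markov_measurable[OF G(1)] norm_markov_le[OF G]]
  have step: "norm (?A G (Suc n) - ?A G n - e *\<^sub>R ?A D n) \<le> d" for n
  proof -
    have "?A G (Suc n) - ?A G n - e *\<^sub>R ?A D n
        = (\<integral>\<omega>. markov G (path S x \<omega> n) - G (path S x \<omega> n) - e *\<^sub>R D (path S x \<omega> n) \<partial>\<Omega>)"
      unfolding integral_path_Suc[OF G] using int by simp
    also have "norm \<dots> \<le> d"
      by (intro seq.P.norm_integral_le_const) (simp add: gen, rule order_trans[OF norm_ge_zero gen])
    finally show ?thesis .
  qed
  have "norm (?A G N - ?A G 0 - e *\<^sub>R (\<Sum>n<N. ?A D n)) = norm (\<Sum>n<N. ?A G (Suc n) - ?A G n - e *\<^sub>R ?A D n)"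
    by (simp only: sum_subtractf[of _ "\<lambda>n. e *\<^sub>R ?A D n"] scaleR_sum_right sum_lessThan_telescope[of "?A G" N])
  also have "\<dots> \<le> (\<Sum>n<N. d)"
    by (intro sum_norm_le step)
  finally have 1: "norm (?A G N - ?A G 0 - e *\<^sub>R (\<Sum>n<N. ?A D n)) \<le> real N * d" by simp
  have 2: "norm (?A G n) \<le> B" for n
    by (intro seq.P.norm_integral_le_const) (simp add: G(2), rule order_trans[OF norm_ge_zero G(2)])
  have "norm c \<le> real N * d + 2 * B" if "norm (a - b - c) \<le> real N * d" "norm a \<le> B" "norm b \<le> B" for a b c :: 'b
    using that norm_triangle_ineq4[of "a - b" "a - b - c"] norm_triangle_ineq4[of a b] by simp
  from this[OF 1 2 2] have "norm (e *\<^sub>R (\<Sum>n<N. ?A D n)) \<le> real N * d + 2 * B" .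
  moreover have "average x N D = (1 / (e * real N)) *\<^sub>R (e *\<^sub>R (\<Sum>n<N. ?A D n))"
    unfolding average_def using \<open>e > 0\<close> by (simp add: Bochner_Integration.integral_sum[OF int(2)])
  ultimately have "norm (average x N D) \<le> 1 / (e * real N) * (real N * d + 2 * B)"
    using mult_left_mono[of "norm (e *\<^sub>R (\<Sum>n<N. ?A D n))" "real N * d + 2 * B" "1 / (e * real N)"] \<open>e > 0\<close>
    by simp
  also have "\<dots> = d / e + 2 * B / (e * real N)"
    using \<open>e > 0\<close> \<open>N \<ge> 1\<close> by (simp add: field_simps)
  finally show ?thesis .
qed

text \<open>One small complex number does both jobs: the real part of the average of D bounds the
  dominating function, and its imaginary part bounds the correction term.\<close>

lemma average_dominated:
  fixes D :: "'x \<Rightarrow> complex" and h :: "'x \<Rightarrow> real"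
  assumes h: "h \<in> borel_measurable borel" "\<And>x. norm (h x) \<le> B"
    and D: "D \<in> borel_measurable borel" "\<And>x. norm (D x) \<le> B'"
    and dom: "\<And>x. \<bar>h x - a + c * Im (D x)\<bar> \<le> c' * Re (D x)"
    and "N \<ge> 1" "c' \<ge> 0"
  shows "\<bar>average x N h - a\<bar> \<le> (\<bar>c\<bar> + c') * norm (average x N D)"
proof -
  note inth = integrable_path[OF h] and intD = integrable_path[OF D]
  define J where "J = (\<integral>\<omega>. (\<Sum>n<N. h (path S x \<omega> n)) \<partial>\<Omega>)"
  define L where "L = (\<integral>\<omega>. (\<Sum>n<N. D (path S x \<omega> n)) \<partial>\<Omega>)"
  have intDs: "integrable \<Omega> (\<lambda>\<omega>. \<Sum>n<N. D (path S x \<omega> n))"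
    and inths: "integrable \<Omega> (\<lambda>\<omega>. \<Sum>n<N. h (path S x \<omega> n))"
    by (intro Bochner_Integration.integrable_sum intD inth)+
  have eq: "J - real N * a + c * Im L
     = (\<integral>\<omega>. (\<Sum>n<N. h (path S x \<omega> n)) - real N * a + c * Im (\<Sum>n<N. D (path S x \<omega> n)) \<partial>\<Omega>)"
    unfolding J_def L_def using intDs inths
    by (simp add: seq.P.prob_space del: Im_sum)
  also have "\<bar>\<dots>\<bar> \<le> (\<integral>\<omega>. c' * Re (\<Sum>n<N. D (path S x \<omega> n)) \<partial>\<Omega>)"
  proof -
    have "\<bar>(\<Sum>n<N. h (path S x \<omega> n)) - real N * a + c * Im (\<Sum>n<N. D (path S x \<omega> n))\<bar>
        \<le> c' * Re (\<Sum>n<N. D (path S x \<omega> n))" for \<omega>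
    proof -
      have "(\<Sum>n<N. h (path S x \<omega> n)) - real N * a + c * Im (\<Sum>n<N. D (path S x \<omega> n))
          = (\<Sum>n<N. h (path S x \<omega> n) - a + c * Im (D (path S x \<omega> n)))"
        by (simp add: sum.distrib sum_subtractf sum_distrib_left)
      also have "\<bar>\<dots>\<bar> \<le> (\<Sum>n<N. c' * Re (D (path S x \<omega> n)))"
        by (rule order_trans[OF sum_abs]) (intro sum_mono dom)
      finally show ?thesis by (simp add: sum_distrib_left)
    qed
    then show ?thesis
      using intDs inths by (intro order_trans[OF integral_abs_bound] integral_mono) (auto simp del: Im_sum Re_sum)
  qed
  also have "\<dots> = c' * Re L"
    unfolding L_def using intDs by (simp del: Re_sum)
  finally have *: "\<bar>J - real N * a + c * Im L\<bar> \<le> c' * Re L" .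
  have "\<bar>J - real N * a\<bar> \<le> \<bar>J - real N * a + c * Im L\<bar> + \<bar>c\<bar> * \<bar>Im L\<bar>"
    by (simp add: abs_mult[symmetric])
  also have "\<dots> \<le> c' * norm L + \<bar>c\<bar> * norm L"
    using mult_left_mono[OF complex_Re_le_cmod[of L] \<open>c' \<ge> 0\<close>]
    by (intro add_mono mult_left_mono abs_Im_le_cmod) (use * in auto)
  finally have J: "\<bar>J - real N * a\<bar> \<le> (\<bar>c\<bar> + c') * norm L" by (simp add: algebra_simps)
  have "average x N h - a = (1 / real N) * (J - real N * a)"
    using \<open>N \<ge> 1\<close> by (simp add: average_def J_def field_simps)
  then have "\<bar>average x N h - a\<bar> = (1 / real N) * \<bar>J - real N * a\<bar>"
    by (simp only: abs_mult) simp
  also have "\<dots> \<le> (1 / real N) * ((\<bar>c\<bar> + c') * norm L)"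
    by (intro mult_left_mono J) simp
  also have "\<dots> = (\<bar>c\<bar> + c') * norm (average x N D)"
    by (simp add: average_def L_def)
  finally show ?thesis .
qed

end

section \<open>The projective action\<close>

text \<open>Here a is the relative displacement of z, and the quotient is the factor picked up by
  \<zeta>. In the linear term a is replaced by \<open>a1\<close> up to \<rho>; the quadratic term
  tolerates the cruder b, since its error \<tau> comes with a factor s.\<close>

lemma norm_Cayley_expansion:
  fixes a a1 b :: complex
  assumes "norm a \<le> 1/2" "norm a \<le> s" "norm b \<le> s" "norm (a - a1) \<le> \<rho>" "norm (a - b) \<le> \<tau>"
  shows "norm ((1 + a) / (1 + cnj a) - (1 + (a1 - cnj a1) + ((cnj b)\<^sup>2 - b * cnj b)))
    \<le> 2 * s ^ 3 + 2 * \<rho> + 4 * s * \<tau>"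
proof -
  have "cnj a \<noteq> - 1"
    using assms(1) complex_mod_cnj[of a] by (auto simp del: complex_mod_cnj)
  then have nz: "1 + cnj a \<noteq> 0" by (metis add_eq_0_iff)
  have cn: "norm (1 + cnj a) = norm (1 + a)" by (metis complex_cnj_add complex_cnj_one complex_mod_cnj)
  \<comment> \<open>The geometric series of 1 / (1 + conj a) is stopped after the quadratic term.
    Both pieces of the exact remainder have modulus |a|^3, because |1 + a| = |1 + conj a|.\<close>
  have "(1 + a) / (1 + cnj a) - (1 + (a - cnj a) + ((cnj a)\<^sup>2 - a * cnj a))
      = a * (cnj a)\<^sup>2 - (1 + a) * (cnj a) ^ 3 / (1 + cnj a)"
    using nz by (simp add: divide_simps) (simp add: algebra_simps power2_eq_square power3_eq_cube)
  also have "norm \<dots> \<le> norm (a * (cnj a)\<^sup>2) + norm ((1 + a) * (cnj a) ^ 3 / (1 + cnj a))"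
    by (rule norm_triangle_ineq4)
  also have "\<dots> = 2 * norm a ^ 3"
    using nz cn by (auto simp: norm_mult norm_divide norm_power power2_eq_square power3_eq_cube)
  also have "\<dots> \<le> 2 * s ^ 3"
    using assms by (intro mult_left_mono power_mono) auto
  finally have 1: "norm ((1 + a) / (1 + cnj a) - (1 + (a - cnj a) + ((cnj a)\<^sup>2 - a * cnj a))) \<le> 2 * s ^ 3" .
  have "norm ((a - cnj a) - (a1 - cnj a1)) = norm ((a - a1) - cnj (a - a1))"
    by (simp add: algebra_simps)
  also have "\<dots> \<le> norm (a - a1) + norm (cnj (a - a1))" by (rule norm_triangle_ineq4)
  finally have 2: "norm ((a - cnj a) - (a1 - cnj a1)) \<le> 2 * \<rho>"
    using assms(4) by (simp del: complex_cnj_diff)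
  have "((cnj a)\<^sup>2 - a * cnj a) - ((cnj b)\<^sup>2 - b * cnj b)
      = cnj (a - b) * (cnj a + cnj b) - ((a - b) * cnj a + b * cnj (a - b))"
    by (simp add: algebra_simps power2_eq_square)
  also have "norm \<dots> \<le> norm (a - b) * (norm a + norm b) + (norm (a - b) * norm a + norm b * norm (a - b))"
  proof (rule order_trans[OF norm_triangle_ineq4], rule add_mono)
    have "norm (cnj a + cnj b) \<le> norm a + norm b"
      by (rule order_trans[OF norm_triangle_ineq]) simp
    then show "norm (cnj (a - b) * (cnj a + cnj b)) \<le> norm (a - b) * (norm a + norm b)"
      unfolding norm_mult complex_mod_cnj by (intro mult_left_mono) auto
    show "norm ((a - b) * cnj a + b * cnj (a - b)) \<le> norm (a - b) * norm a + norm b * norm (a - b)"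
      by (rule order_trans[OF norm_triangle_ineq]) (simp only: norm_mult complex_mod_cnj order_refl)
  qed
  also have "\<dots> = norm (a - b) * (2 * norm a + 2 * norm b)" by (simp add: algebra_simps)
  also have "\<dots> \<le> \<tau> * (2 * s + 2 * s)"
    using assms by (intro mult_mono add_mono mult_left_mono) (auto intro: order_trans[OF norm_ge_zero])
  finally have 3: "norm (((cnj a)\<^sup>2 - a * cnj a) - ((cnj b)\<^sup>2 - b * cnj b)) \<le> 4 * s * \<tau>"
    by (simp add: algebra_simps)
  have tri: "norm (u - (1 + v' + w')) \<le> A + B + C"
    if "norm (u - (1 + v + w)) \<le> A" "norm (v - v') \<le> B" "norm (w - w') \<le> C" for u v w v' w' :: complex and A B C
  proof -
    have "u - (1 + v' + w') = (u - (1 + v + w)) + (v - v') + (w - w')" by simp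
    then show ?thesis using that by (metis (no_types, lifting) add_mono norm_triangle_le)
  qed
  show ?thesis by (rule tri[OF 1 2 3])
qed

text \<open>This is exp(2 i arg(l v)): doubling the angle identifies the projective line with the
  unit circle. The linear chart l stays a parameter so that it can be adapted to the fixed
  direction.\<close>

definition direction :: "('v \<Rightarrow> complex) \<Rightarrow> 'v \<Rightarrow> complex" where
  "direction l v = l v / cnj (l v)"

lemma norm_direction: "l v \<noteq> 0 \<Longrightarrow> norm (direction l v) = 1"
  by (simp add: direction_def norm_divide)

lemma norm_direction_le: "norm (direction l v) \<le> 1"
  by (simp add: direction_def norm_divide divide_le_eq_1)

text \<open>Nilpotency of Q is decisive: it removes Q^2 from the exponential, so the square of Q + Y
  is only O(s t) and the displacement differs from its linear part \<open>a1\<close> by O(s t +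
  s^3). In the quadratic term, replacing Q + Y by Q again costs O(s t). The condition on s keeps the
  displacement below 1/2.\<close>

lemma norm_direction_step:
  fixes l :: "real^2 \<Rightarrow> complex" and Q Y :: mat2
  assumes lin: "linear l"
    and bnd: "\<And>X. norm (l (X *v v)) \<le> \<Lambda> * norm X * norm (l v)" and \<Lambda>: "\<Lambda> \<ge> 1"
    and v: "l v \<noteq> 0"
    and QQ: "Q ** Q = 0" and Qs: "norm Q \<le> s" and Yt: "norm Y \<le> t" "t \<le> s" and s: "8 * \<Lambda> * s \<le> 1"
  defines "a1 \<equiv> l ((Q + Y) *v v) / l v" and "b \<equiv> l (Q *v v) / l v"
  shows "norm (direction l (mexp (Q + Y) *v v)
      - direction l v * (1 + (a1 - cnj a1) + ((cnj b)\<^sup>2 - b * cnj b))) \<le> 300 * \<Lambda> ^ 3 * (s * t + s ^ 3)"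
proof -
  define X where "X = Q + Y"
  define R where "R = mexp X - (mat 1 + X + (1/2) *\<^sub>R (X ** X))"
  define a where "a = l (mexp X *v v) / l v - 1"
  have quot: "norm (l (Z *v v) / l v) \<le> \<Lambda> * c" if "norm Z \<le> c" for Z c
  proof -
    have "norm (l (Z *v v)) \<le> \<Lambda> * c * norm (l v)"
      using that \<Lambda> by (intro order_trans[OF bnd] mult_right_mono mult_left_mono) auto
    then show ?thesis using v by (simp add: norm_divide divide_le_eq)
  qed
  have t0: "0 \<le> t" and s0: "0 \<le> s" using Yt(1) Qs norm_ge_zero order_trans by blast+
  have s8: "s \<le> 1/8" using \<Lambda> s s0 mult_right_mono[of 1 \<Lambda> s] by linarith
  have X2s: "norm X \<le> 2 * s"
    unfolding X_def using norm_triangle_ineq[of Q Y] Qs Yt by linarith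
  have "norm R \<le> 6 * norm X ^ 3"
    unfolding R_def by (rule norm_mexp_remainder_le) (use X2s s8 in linarith)
  also have "\<dots> \<le> 6 * (2 * s) ^ 3"
    by (intro mult_left_mono power_mono X2s) auto
  finally have R: "norm R \<le> 48 * s ^ 3" by (simp add: power_mult_distrib)
  have "X ** X = Q ** Y + Y ** Q + Y ** Y"
    unfolding X_def using QQ by (simp add: matrix_add_ldistrib matrix_mult_add_rdistrib)
  also have "norm \<dots> \<le> norm Q * norm Y + norm Y * norm Q + norm Y * norm Y"
    by (intro norm_triangle_le add_mono norm_matrix_mult_le)
  also have "\<dots> \<le> s * t + t * s + s * t"
    using Qs Yt t0 s0 by (intro add_mono mult_mono) auto
  finally have XX: "norm (X ** X) \<le> 3 * (s * t)" by simp
  have "norm ((1/2) *\<^sub>R (X ** X) + R) \<le> 2 * (s * t) + 48 * s ^ 3"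
    using XX R mult_nonneg_nonneg[OF s0 t0] by (intro norm_triangle_le add_mono) auto
  then have bd2: "norm (l (((1/2) *\<^sub>R (X ** X) + R) *v v) / l v) \<le> \<Lambda> * (2 * (s * t) + 48 * s ^ 3)"
    by (rule quot)
  have mexpX: "mexp X = mat 1 + X + ((1/2) *\<^sub>R (X ** X) + R)"
    by (simp add: R_def)
  have "mexp X *v v = v + X *v v + ((1/2) *\<^sub>R (X ** X) + R) *v v"
    unfolding mexpX by (simp add: matrix_vector_mult_add_rdistrib)
  then have "l (mexp X *v v) = l v + l (X *v v) + l (((1/2) *\<^sub>R (X ** X) + R) *v v)"
    by (simp only: linear_add[OF lin])
  then have aa1: "a - a1 = l (((1/2) *\<^sub>R (X ** X) + R) *v v) / l v"
    unfolding a_def a1_def X_def[symmetric] using v by (simp add: field_simps)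
  define \<rho> where "\<rho> = \<Lambda> * (2 * (s * t) + 48 * s ^ 3)"
  have \<rho>: "norm (a - a1) \<le> \<rho>" using bd2 by (simp add: aa1 \<rho>_def)
  have "a1 - b = l (Y *v v) / l v"
    unfolding a1_def b_def matrix_vector_mult_add_rdistrib linear_add[OF lin] by (simp add: add_divide_distrib)
  then have a1b: "norm (a1 - b) \<le> \<Lambda> * t"
    using quot[OF Yt(1)] by simp
  have \<tau>: "norm (a - b) \<le> \<Lambda> * t + \<rho>"
    using norm_triangle_ineq[of "a - a1" "a1 - b"] \<rho> a1b by simp
  have b: "norm b \<le> \<Lambda> * s"
    unfolding b_def by (rule quot[OF Qs])
  \<comment> \<open>Besides its accurate size, \<rho> needs a crude bound by \<Lambda> s in order to
    bound a. The threshold s \<le> 1/8 gives exactly 2/8 + 48/64 = 1.\<close>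
  have "2 * (s * t) + 48 * s ^ 3 \<le> s"
  proof -
    have "s * t \<le> s * (1/8)" using s0 Yt s8 by (intro mult_left_mono) auto
    moreover have "s ^ 3 \<le> s * (1/64)"
      using s0 s8 power_mono[of s "1/8" 2] mult_left_mono[of "s ^ 2" "1/64" s]
      by (simp add: power3_eq_cube power2_eq_square)
    ultimately show ?thesis by linarith
  qed
  then have \<rho>s: "\<rho> \<le> \<Lambda> * s" unfolding \<rho>_def using \<Lambda> by (intro mult_left_mono) auto
  have "\<Lambda> * t \<le> \<Lambda> * s" using Yt(2) \<Lambda> by simp
  then have a: "norm a \<le> 3 * \<Lambda> * s"
    using norm_triangle_ineq[of "a - b" b] \<tau> b \<rho>s unfolding mult.assoc diff_add_cancel by linarith
  have b': "norm b \<le> 3 * \<Lambda> * s" using b s0 \<Lambda> by (simp add: order_trans)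
  have a2: "norm a \<le> 1/2" using a s by linarith
  have dir: "direction l (mexp X *v v) = direction l v * ((1 + a) / (1 + cnj a))"
    unfolding direction_def a_def using v by simp
  have "norm (direction l (mexp X *v v) - direction l v * (1 + (a1 - cnj a1) + ((cnj b)\<^sup>2 - b * cnj b)))
     = norm ((1 + a) / (1 + cnj a) - (1 + (a1 - cnj a1) + ((cnj b)\<^sup>2 - b * cnj b)))"
    unfolding dir right_diff_distrib[symmetric] norm_mult norm_direction[of l v, OF v] by simp
  also have "\<dots> \<le> 2 * (3 * \<Lambda> * s) ^ 3 + 2 * \<rho> + 4 * (3 * \<Lambda> * s) * (\<Lambda> * t + \<rho>)"
    by (rule norm_Cayley_expansion[OF a2 a b' \<rho> \<tau>])
  also have "\<dots> = 54 * (\<Lambda> ^ 3 * s ^ 3) + 2 * \<rho> + 12 * (\<Lambda> ^ 2 * (s * t)) + (12 * \<Lambda> * s) * \<rho>"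
    by (simp add: power_mult_distrib algebra_simps power2_eq_square)
  also have "\<dots> \<le> 54 * (\<Lambda> ^ 3 * s ^ 3) + 2 * \<rho> + 12 * (\<Lambda> ^ 2 * (s * t)) + 2 * \<rho>"
  proof -
    have "\<rho> \<ge> 0" using \<rho> norm_ge_zero order_trans by blast
    then have "(12 * \<Lambda> * s) * \<rho> \<le> 2 * \<rho>" using s by (intro mult_right_mono) auto
    then show ?thesis by simp
  qed
  also have "\<dots> \<le> 300 * \<Lambda> ^ 3 * (s * t + s ^ 3)"
  proof -
    \<comment> \<open>With all powers of \<Lambda> raised to the third, the coefficients are 8 + 12
      = 20 for s t and 54 + 192 = 246 for s^3; both are rounded up to 300.\<close>
    have st: "0 \<le> s * t" "0 \<le> s ^ 3" using s0 t0 by auto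
    have L: "\<Lambda> \<le> \<Lambda> ^ 3" "\<Lambda> ^ 2 \<le> \<Lambda> ^ 3"
      using power_increasing[of 1 3 \<Lambda>] power_increasing[of 2 3 \<Lambda>] \<Lambda> by auto
    have "\<rho> = 2 * (\<Lambda> * (s * t)) + 48 * (\<Lambda> * s ^ 3)"
      by (simp add: \<rho>_def algebra_simps)
    moreover have "300 * \<Lambda> ^ 3 * (s * t + s ^ 3) = 300 * (\<Lambda> ^ 3 * (s * t)) + 300 * (\<Lambda> ^ 3 * s ^ 3)"
      by (simp add: algebra_simps)
    moreover have "0 \<le> \<Lambda> ^ 3 * (s * t)" "0 \<le> \<Lambda> ^ 3 * s ^ 3"
      using st \<Lambda> by auto
    ultimately show ?thesis
      using mult_right_mono[OF L(1) st(1)] mult_right_mono[OF L(1) st(2)] mult_right_mono[OF L(2) st(1)]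
      by linarith
  qed
  finally show ?thesis unfolding X_def .
qed

section \<open>The limiting drift on the circle\<close>

text \<open>Only $\zeta$ on the unit circle matters; $\zeta = 0$ is the value of \<open>direction l\<close> at the origin
  (division by zero), which every linear step fixes.\<close>
definition drift :: "real \<Rightarrow> complex \<Rightarrow> complex" where
  "drift A \<zeta> = (if \<zeta> = 0 then 0
     else of_real A * (1 - \<zeta>\<^sup>2) + of_real (A * (1 - Re \<zeta>) / 4) * (\<zeta> * (\<zeta> - 1)))"

lemma drift_measurable [measurable]: "drift A \<in> borel_measurable borel"
  unfolding drift_def[abs_def] by measurable

lemma norm_drift_le:
  assumes "norm \<zeta> \<le> 1"
  shows "norm (drift A \<zeta>) \<le> 3 * \<bar>A\<bar>"
proof -
  have 1: "norm (1 - \<zeta>\<^sup>2) \<le> 2"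
    using norm_triangle_ineq4[of 1 "\<zeta>\<^sup>2"] power_mono[OF assms, of 2] by (simp add: norm_power)
  have 2: "norm (\<zeta> * (\<zeta> - 1)) \<le> 1 * 2"
    unfolding norm_mult using assms norm_triangle_ineq4[of \<zeta> 1] by (intro mult_mono) auto
  have "\<bar>1 - Re \<zeta>\<bar> \<le> 2" using abs_Re_le_cmod[of \<zeta>] assms by linarith
  then have 3: "\<bar>A * (1 - Re \<zeta>) / 4\<bar> \<le> \<bar>A\<bar> / 2"
    by (simp add: abs_mult) (metis abs_ge_zero mult.commute mult_left_mono)
  have "norm (of_real A * (1 - \<zeta>\<^sup>2) + of_real (A * (1 - Re \<zeta>) / 4) * (\<zeta> * (\<zeta> - 1)))
      \<le> \<bar>A\<bar> * 2 + \<bar>A\<bar> / 2 * 2"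
    by (rule order_trans[OF norm_triangle_ineq], rule add_mono;
        unfold norm_mult[of "of_real _"] norm_of_real, rule mult_mono) (use 1 2 3 in auto)
  then show ?thesis by (simp add: drift_def)
qed

text \<open>After y^2 = 1 - x^2 is used, the factor 1 - x splits off, and what remains is at least 1
  since x + 5/2 > 0 and 1 + x \<ge> 0. Equality holds at \<zeta> = -1, where the value A is due to
  the noise alone.\<close>

lemma Re_drift_ge:
  assumes "norm \<zeta> = 1" "A > 0"
  shows "A * (1 - Re \<zeta>) / 2 \<le> Re (drift A \<zeta>)"
proof -
  define x y where "x = Re \<zeta>" and "y = Im \<zeta>"
  have xy: "y\<^sup>2 = 1 - x\<^sup>2"
    using assms(1) cmod_power2[of \<zeta>] by (simp add: x_def y_def)
  have x: "-1 \<le> x" "x \<le> 1"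
    using abs_Re_le_cmod[of \<zeta>] assms(1) by (auto simp: x_def)
  have "\<zeta> \<noteq> 0" using assms(1) by auto
  then have "Re (drift A \<zeta>) = A * (1 - (x\<^sup>2 - y\<^sup>2)) + A * (1 - x) / 4 * (x * (x - 1) - y * y)"
    by (simp add: drift_def x_def y_def Re_power2)
  \<comment> \<open>The inserted multiples of x^2 - 1 + y^2 vanish on the unit circle.\<close>
  also have "\<dots> = A * (2 * y\<^sup>2 + (x\<^sup>2 - 1 + y\<^sup>2)) + A * (1 - x) / 4 * (x * (x - 1) - y\<^sup>2) - A * (2 * (x\<^sup>2 - 1 + y\<^sup>2))"
    by (simp add: algebra_simps power2_eq_square)
  also have "\<dots> = A * (1 - x) / 2 * (1 + (1 + x) * (x + 5 / 2))"
    unfolding xy by (simp add: field_simps power2_eq_square)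
  finally have eq: "Re (drift A \<zeta>) = A * (1 - x) / 2 * (1 + (1 + x) * (x + 5 / 2))" .
  have "A * (1 - x) / 2 * 1 \<le> A * (1 - x) / 2 * (1 + (1 + x) * (x + 5 / 2))"
    using x assms(2) by (intro mult_left_mono) auto
  then show ?thesis by (simp add: eq x_def)
qed

lemma Im_drift_approx:
  assumes "norm \<zeta> = 1" "A > 0"
  shows "\<bar>Im (drift A \<zeta>) + 2 * A * Im \<zeta>\<bar> \<le> 3 * A * (1 - Re \<zeta>)"
proof -
  define x y where "x = Re \<zeta>" and "y = Im \<zeta>"
  have x: "-1 \<le> x" "x \<le> 1" and y: "\<bar>y\<bar> \<le> 1"
    using abs_Re_le_cmod[of \<zeta>] abs_Im_le_cmod[of \<zeta>] assms(1) by (auto simp: x_def y_def)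
  have "\<zeta> \<noteq> 0" using assms(1) by auto
  then have "Im (drift A \<zeta>) + 2 * A * y = A * (1 - x) * (y * (2 + (2 * x - 1) / 4))"
    by (simp add: drift_def x_def y_def Im_power2) (simp add: field_simps)
  also have "\<bar>\<dots>\<bar> = A * (1 - x) * (\<bar>y\<bar> * \<bar>2 + (2 * x - 1) / 4\<bar>)"
    using x assms(2) by (simp add: abs_mult)
  moreover have "\<bar>2 + (2 * x - 1) / 4\<bar> \<le> 3" using x by (auto simp: abs_le_iff field_simps)
  then have "A * (1 - x) * (\<bar>y\<bar> * \<bar>2 + (2 * x - 1) / 4\<bar>) \<le> A * (1 - x) * (1 * 3)"
    using x y assms(2) by (intro mult_left_mono mult_mono) auto
  ultimately show ?thesis by (simp add: x_def y_def mult_ac)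
qed

lemma direction_eq: "direction l v = (l v)\<^sup>2 / of_real ((norm (l v))\<^sup>2)"
  unfolding complex_norm_square by (simp add: direction_def power2_eq_square)

text \<open>This is the half-angle formula, sin^2 = (1 - cos of the double angle) / 2, for the
  argument of l v.\<close>

lemma Im_squared_direction:
  assumes "l v \<noteq> 0"
  shows "(Im (l v))\<^sup>2 / (norm (l v))\<^sup>2 = (1 - Re (direction l v)) / 2"
proof -
  have "Re (direction l v) = ((Re (l v))\<^sup>2 - (Im (l v))\<^sup>2) / (norm (l v))\<^sup>2"
    by (simp add: direction_eq Re_power2 flip: of_real_power)
  moreover have "(norm (l v))\<^sup>2 = (Re (l v))\<^sup>2 + (Im (l v))\<^sup>2" "(norm (l v))\<^sup>2 \<noteq> 0"
    using assms by (simp_all only: cmod_power2[symmetric]) simp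
  ultimately show ?thesis
    by (simp add: field_simps del: norm_eq_zero power_eq_0_iff)
qed

lemma direction_measurable [measurable]:
  fixes l :: "real^2 \<Rightarrow> complex"
  assumes "linear l"
  shows "direction l \<in> borel_measurable borel"
proof -
  have [measurable]: "l \<in> borel_measurable borel"
    using assms by (intro borel_measurable_continuous_onI linear_continuous_on)
      (simp add: linear_conv_bounded_linear)
  have [measurable]: "cnj \<in> borel_measurable borel"
    by (intro borel_measurable_continuous_onI continuous_intros)
  show ?thesis unfolding direction_def[abs_def] by measurable
qed

text \<open>In the chart l the mean R acts as A times complex conjugation, so its relative
  displacement is A conj \<zeta>, which contributes \<zeta> A (conj \<zeta> - \<zeta>) = A(1 -
  \<zeta>^2). The nilpotent part has b = e \<beta> Im(l v) / l v. Its quadratic term is e^2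
  \<beta>^2 (1 - Re \<zeta>)(\<zeta> - 1) / 2, and averaging with mean A/2 of \<beta>^2 gives the
  second summand of \<open>drift\<close>.\<close>

lemma (in prob_space) expected_direction_step:
  fixes l :: "real^2 \<Rightarrow> complex" and X Q Y :: "'a \<Rightarrow> mat2" and \<beta> :: "'a \<Rightarrow> real" and R :: mat2
  assumes lin: "linear l"
    and bnd: "\<And>X v. norm (l (X *v v)) \<le> \<Lambda> * norm X * norm (l v)" and \<Lambda>: "\<Lambda> \<ge> 1"
    and X [measurable]: "X \<in> borel_measurable M" and XQY: "\<And>\<sigma>. X \<sigma> = Q \<sigma> + Y \<sigma>"
    and QQ: "AE \<sigma> in M. Q \<sigma> ** Q \<sigma> = 0 \<and> (\<forall>v. l (Q \<sigma> *v v) = of_real (e * \<beta> \<sigma> * Im (l v)))"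
    and Qs: "\<And>\<sigma>. norm (Q \<sigma>) \<le> s" and Yt: "\<And>\<sigma>. norm (Y \<sigma>) \<le> t" "t \<le> s" and s: "8 * \<Lambda> * s \<le> 1"
    and \<beta>: "integrable M (\<lambda>\<sigma>. (\<beta> \<sigma>)\<^sup>2)" "expectation (\<lambda>\<sigma>. (\<beta> \<sigma>)\<^sup>2) = A / 2"
    and R: "l (R *v v) = of_real A * cnj (l v)"
    and EX: "norm (expectation X - e\<^sup>2 *\<^sub>R R) \<le> w"
  shows "norm (expectation (\<lambda>\<sigma>. direction l (mexp (X \<sigma>) *v v)) - direction l v - e\<^sup>2 *\<^sub>R drift A (direction l v))
    \<le> 300 * \<Lambda> ^ 3 * (s * t + s ^ 3) + 2 * \<Lambda> * w"
proof (cases "l v = 0")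
  \<comment> \<open>The bound \<open>bnd\<close> makes the kernel of l invariant under every matrix,
    so both directions and the drift are 0 there.\<close>
  case True
  have "l (Z *v v) = 0" for Z using bnd[of Z v] True by simp
  moreover have "0 \<le> s" "0 \<le> t" "0 \<le> w" 
    using order_trans[OF norm_ge_zero] Qs Yt(1) EX by blast+
  ultimately show ?thesis
    using True \<Lambda> by (simp add: direction_def drift_def)
next
  case v: False
  define \<zeta> where "\<zeta> = direction l v"
  define a where "a = (\<lambda>Z. l (Z *v v) / l v)"
  define c where "c = of_real ((1 - Re \<zeta>) / 2) * (\<zeta> - 1)"
  define F where "F = (\<lambda>\<sigma>. direction l (mexp (X \<sigma>) *v v))"
  \<comment> \<open>H is the second order expansion of F. It depends on \<sigma> only through a
    linear function of X and through \<beta>^2, so its expectation can be computed exactly.\<close>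
  define H where "H = (\<lambda>\<sigma>. \<zeta> * (1 + (a (X \<sigma>) - cnj (a (X \<sigma>))) + of_real (e\<^sup>2 * (\<beta> \<sigma>)\<^sup>2) * c))"
  have \<zeta>1: "norm \<zeta> = 1" using v by (simp add: \<zeta>_def norm_direction)
  then have \<zeta>\<zeta>: "\<zeta> * cnj \<zeta> = 1" by (simp add: complex_norm_square[symmetric])
  have cnj\<zeta>: "cnj \<zeta> = cnj (l v) / l v" by (simp add: \<zeta>_def direction_def)
  have quad: "(cnj b)\<^sup>2 - b * cnj b = of_real (e\<^sup>2 * k\<^sup>2) * c"
    if "b = of_real (e * k * Im (l v)) / l v" for b k
  proof -
    have "(cnj b)\<^sup>2 - b * cnj b = of_real ((e * k * Im (l v))\<^sup>2) * (1 / (cnj (l v))\<^sup>2 - 1 / (l v * cnj (l v)))"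
      by (simp add: that power2_eq_square algebra_simps)
    also have "1 / (cnj (l v))\<^sup>2 - 1 / (l v * cnj (l v)) = (\<zeta> - 1) / (l v * cnj (l v))"
      using v by (simp add: \<zeta>_def direction_def power2_eq_square field_simps)
    also have "of_real ((e * k * Im (l v))\<^sup>2) * ((\<zeta> - 1) / (l v * cnj (l v)))
        = of_real (e\<^sup>2 * k\<^sup>2 * ((Im (l v))\<^sup>2 / (norm (l v))\<^sup>2)) * (\<zeta> - 1)"
      by (simp add: complex_norm_square[symmetric] power_mult_distrib)
    also have "\<dots> = of_real (e\<^sup>2 * k\<^sup>2) * c"
      unfolding Im_squared_direction[of l v, OF v] c_def \<zeta>_def by simp
    finally show ?thesis .
  qed
  have FH: "AE \<sigma> in M. norm (F \<sigma> - H \<sigma>) \<le> 300 * \<Lambda> ^ 3 * (s * t + s ^ 3)"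
    using QQ
  proof eventually_elim
    case (elim \<sigma>)
    then have "(cnj (a (Q \<sigma>)))\<^sup>2 - a (Q \<sigma>) * cnj (a (Q \<sigma>)) = of_real (e\<^sup>2 * (\<beta> \<sigma>)\<^sup>2) * c"
      by (intro quad) (simp add: a_def)
    then show ?case
      using norm_direction_step[OF lin bnd \<Lambda> v _ Qs Yt s, of \<sigma> \<sigma>] elim
      unfolding F_def H_def XQY a_def \<zeta>_def by simp
  qed
  have bl: "bounded_linear a"
  proof -
    have "linear a" unfolding a_def
      by (intro linearI) (simp_all add: matrix_vector_mult_add_rdistrib linear_add[OF lin] distrib_right
        scaleR_matrix_vector_assoc[symmetric] linear_scale[OF lin] divide_inverse distrib_right)
    then show ?thesis by (simp add: linear_conv_bounded_linear)
  qed
  have intX: "integrable M X"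
  proof (rule integrable_const_bound[of _ "s + t"])
    show "AE \<sigma> in M. norm (X \<sigma>) \<le> s + t"
      unfolding XQY using Qs Yt by (auto intro!: AE_I2 norm_triangle_le add_mono)
  qed simp
  note inta = integrable_bounded_linear[OF bl intX]
  have intF: "integrable M F"
  proof (rule integrable_const_bound[of _ 1])
    have [measurable]: "(\<lambda>Z. direction l (mexp Z *v v)) \<in> borel_measurable borel"
    proof -
      note direction_measurable[OF lin, measurable]
      have [measurable]: "(\<lambda>Z::mat2. Z *v v) \<in> borel_measurable borel"
        unfolding matrix_vector_mult_def by (intro borel_measurable_continuous_onI continuous_intros)
      show ?thesis by measurable
    qed
    show "F \<in> borel_measurable M" unfolding F_def by measurable
  qed (simp add: F_def norm_direction_le)
  have intH: "integrable M H"
    unfolding H_def using inta \<beta>(1) by (intro integrable_mult_right Bochner_Integration.integrable_add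
      Bochner_Integration.integrable_diff integrable_mult_left integrable_of_real integrable_cnj integrable_const) auto
  have "expectation F - expectation H = expectation (\<lambda>\<sigma>. F \<sigma> - H \<sigma>)"
    using intF intH by simp
  also have "norm \<dots> \<le> 300 * \<Lambda> ^ 3 * (s * t + s ^ 3)"
  proof (rule norm_integral_le_const[OF FH])
    have "0 \<le> s" "0 \<le> t" using order_trans[OF norm_ge_zero] Qs Yt(1) by blast+
    then show "0 \<le> 300 * \<Lambda> ^ 3 * (s * t + s ^ 3)" using \<Lambda> by simp
  qed
  finally have 1: "norm (expectation F - expectation H) \<le> 300 * \<Lambda> ^ 3 * (s * t + s ^ 3)" .
  define \<alpha> where "\<alpha> = a (expectation X)"
  have Ea: "expectation (\<lambda>\<sigma>. a (X \<sigma>)) = \<alpha>"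
    unfolding \<alpha>_def by (rule integral_bounded_linear[OF bl intX])
  have intb: "integrable M (\<lambda>\<sigma>. complex_of_real (e\<^sup>2 * (\<beta> \<sigma>)\<^sup>2))"
    by (intro integrable_of_real integrable_mult_right \<beta>(1))
  have Eb: "expectation (\<lambda>\<sigma>. complex_of_real (e\<^sup>2 * (\<beta> \<sigma>)\<^sup>2)) = of_real (e\<^sup>2 * (A / 2))"
    unfolding \<beta>(2)[symmetric] using \<beta>(1) by (subst integral_of_real) simp_all
  have EH: "expectation H = \<zeta> * (1 + (\<alpha> - cnj \<alpha>) + of_real (e\<^sup>2 * (A / 2)) * c)"
    unfolding H_def Ea[symmetric] Eb[symmetric] using inta intb
    by (simp add: prob_space del: of_real_mult of_real_power)
  have "norm (a (expectation X - e\<^sup>2 *\<^sub>R R)) \<le> \<Lambda> * w"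
  proof -
    have "norm (l ((expectation X - e\<^sup>2 *\<^sub>R R) *v v)) \<le> \<Lambda> * w * norm (l v)"
      using EX \<Lambda> by (intro order_trans[OF bnd] mult_right_mono mult_left_mono) auto
    then show ?thesis using v by (simp add: a_def norm_divide divide_le_eq)
  qed
  moreover have "a (expectation X - e\<^sup>2 *\<^sub>R R) = \<alpha> - of_real (e\<^sup>2 * A) * cnj \<zeta>"
    unfolding \<alpha>_def cnj\<zeta> using R bounded_linear.linear[OF bl]
    by (simp add: linear_diff linear_scale) (simp add: a_def scaleR_conv_of_real)
  ultimately have 2: "norm (\<alpha> - of_real (e\<^sup>2 * A) * cnj \<zeta>) \<le> \<Lambda> * w" by simp
  \<comment> \<open>The \<beta>^2 part matches the second summand of the drift exactly; what is left
    comes from the error in the mean of X, once directly and once conjugated, hence the factor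
    2.\<close>
  have "expectation H - \<zeta> - e\<^sup>2 *\<^sub>R drift A \<zeta>
      = \<zeta> * ((\<alpha> - of_real (e\<^sup>2 * A) * cnj \<zeta>) - cnj (\<alpha> - of_real (e\<^sup>2 * A) * cnj \<zeta>))"
  proof -
    have dr: "drift A \<zeta> = of_real A * \<zeta> * (cnj \<zeta> - \<zeta>) + of_real (A / 2) * \<zeta> * c"
    proof -
      have "of_real A * \<zeta> * (cnj \<zeta> - \<zeta>) = of_real A * (\<zeta> * cnj \<zeta> - \<zeta>\<^sup>2)"
        by (simp add: algebra_simps power2_eq_square)
      moreover have "of_real (A / 2) * \<zeta> * c = of_real (A * (1 - Re \<zeta>) / 4) * (\<zeta> * (\<zeta> - 1))"
        unfolding c_def by simp
      moreover have "\<zeta> \<noteq> 0" using \<zeta>1 by auto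
      ultimately show ?thesis by (simp only: \<zeta>\<zeta> drift_def if_False)
    qed
    show ?thesis unfolding EH scaleR_conv_of_real dr by (simp add: algebra_simps)
  qed
  also have "norm \<dots> \<le> \<Lambda> * w + \<Lambda> * w"
    unfolding norm_mult \<zeta>1 by (rule order_trans[OF mult_left_mono[OF norm_triangle_ineq4]])
      (use 2 in \<open>simp_all only: complex_mod_cnj, simp_all\<close>)
  finally have "norm (expectation H - \<zeta> - e\<^sup>2 *\<^sub>R drift A \<zeta>) \<le> 2 * \<Lambda> * w" by simp
  then have 3: "norm ((expectation F - expectation H) + (expectation H - \<zeta> - e\<^sup>2 *\<^sub>R drift A \<zeta>))
      \<le> 300 * \<Lambda> ^ 3 * (s * t + s ^ 3) + 2 * \<Lambda> * w"
    using 1 by (intro norm_triangle_le add_mono)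
  have "(expectation F - expectation H) + (expectation H - \<zeta> - e\<^sup>2 *\<^sub>R drift A \<zeta>)
      = expectation F - \<zeta> - e\<^sup>2 *\<^sub>R drift A \<zeta>" by simp
  with 3 show ?thesis by (simp only: F_def \<zeta>_def)
qed

section \<open>Power series of generators\<close>

locale generator_series = prob_space p for p :: "'s measure" +
  fixes P :: "nat \<Rightarrow> 's \<Rightarrow> mat2" and \<eta> b :: "nat \<Rightarrow> real" and lam0 :: real
  assumes Pmeas: "\<And>k. k \<ge> 1 \<Longrightarrow> P k \<in> borel_measurable p"
    and Pbound: "\<And>k \<sigma>. k \<ge> 1 \<Longrightarrow> norm (P k \<sigma>) \<le> b k"
    and lam0: "lam0 > 0"
    and summ: "summable (\<lambda>k. lam0 powr \<eta> (Suc k) * b (Suc k))"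
    and eta_mono: "\<And>k. k \<ge> 1 \<Longrightarrow> \<eta> k < \<eta> (Suc k)"
begin

text \<open>Indices are shifted by one: summand k carries the exponent and the matrix number k +
  1.\<close>

definition term_at :: "real \<Rightarrow> 's \<Rightarrow> nat \<Rightarrow> mat2" where
  "term_at lam \<sigma> k = lam powr \<eta> (Suc k) *\<^sub>R P (Suc k) \<sigma>"

definition series :: "real \<Rightarrow> 's \<Rightarrow> mat2" where
  "series lam \<sigma> = (\<Sum>k. term_at lam \<sigma> k)"

definition total :: real where
  "total = (\<Sum>k. lam0 powr \<eta> (Suc k) * b (Suc k))"

lemma P_measurable [measurable]: "P (Suc k) \<in> borel_measurable p"
  by (rule Pmeas) simp

lemma b_nonneg: "0 \<le> b (Suc k)"
  using order_trans[OF norm_ge_zero Pbound[of "Suc k"]] by simp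

lemma eta_less: "1 \<le> j \<Longrightarrow> j < k \<Longrightarrow> \<eta> j < \<eta> k"
proof (induction k)
  case (Suc k)
  have "\<eta> k < \<eta> (Suc k)" using Suc.prems by (intro eta_mono) simp
  then show ?case using Suc by (cases "j = k") auto
qed simp

lemma eta_le: "1 \<le> j \<Longrightarrow> j \<le> k \<Longrightarrow> \<eta> j \<le> \<eta> k"
  using eta_less[of j k] by (cases "j = k") auto

lemma total_nonneg: "0 \<le> total"
  unfolding total_def by (intro suminf_nonneg summ mult_nonneg_nonneg b_nonneg) simp

lemma integrable_P: "integrable p (P (Suc k))"
  by (rule integrable_const_bound[of _ "b (Suc k)"]) (simp_all add: Pbound)

lemma series_measurable [measurable]: "series lam \<in> borel_measurable p"
  unfolding series_def[abs_def] term_at_def by measurable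

context
  fixes lam :: real
  assumes lam: "0 < lam" "lam \<le> lam0"
begin

text \<open>As lam / lam0 \<le> 1 and the exponents increase, the power with the first exponent
  dominates all later ones; what remains is a summand of the convergent series at
  \<open>lam0\<close>.\<close>

lemma norm_term_le:
  assumes "j \<le> k"
  shows "norm (term_at lam \<sigma> k) \<le> (lam / lam0) powr \<eta> (Suc j) * (lam0 powr \<eta> (Suc k) * b (Suc k))"
proof -
  have "lam powr \<eta> (Suc k) = (lam / lam0) powr \<eta> (Suc k) * lam0 powr \<eta> (Suc k)"
    using lam lam0 by (simp add: powr_divide)
  also have "\<dots> \<le> (lam / lam0) powr \<eta> (Suc j) * lam0 powr \<eta> (Suc k)"
    using lam lam0 assms by (intro mult_right_mono powr_mono' eta_le) auto
  finally have 1: "lam powr \<eta> (Suc k) \<le> (lam / lam0) powr \<eta> (Suc j) * lam0 powr \<eta> (Suc k)" .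
  have "norm (term_at lam \<sigma> k) = lam powr \<eta> (Suc k) * norm (P (Suc k) \<sigma>)"
    by (simp add: term_at_def)
  also have "\<dots> \<le> ((lam / lam0) powr \<eta> (Suc j) * lam0 powr \<eta> (Suc k)) * b (Suc k)"
    by (intro mult_mono 1 Pbound) auto
  finally show ?thesis by (simp add: mult.assoc)
qed

lemma summable_term: "summable (\<lambda>k. term_at lam \<sigma> k)"
  by (rule summable_comparison_test'[OF summable_mult[OF summ, of "(lam / lam0) powr \<eta> (Suc 0)"], of 0])
    (rule norm_term_le, simp)

lemma norm_tail_le: "norm (\<Sum>k. term_at lam \<sigma> (k + j)) \<le> (lam / lam0) powr \<eta> (Suc j) * total"
proof -
  let ?c = "\<lambda>k. lam0 powr \<eta> (Suc k) * b (Suc k)"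
  have s: "summable (\<lambda>k. ?c (k + j))"
    using summ by (rule summable_ignore_initial_segment)
  have "norm (\<Sum>k. term_at lam \<sigma> (k + j)) \<le> (\<Sum>k. (lam / lam0) powr \<eta> (Suc j) * ?c (k + j))"
    by (rule norm_suminf_le[OF norm_term_le summable_mult[OF s]]) simp
  also have "\<dots> = (lam / lam0) powr \<eta> (Suc j) * (\<Sum>k. ?c (k + j))"
    by (rule suminf_mult[OF s])
  also have "(\<Sum>k. ?c (k + j)) \<le> total"
  proof -
    have "total = (\<Sum>k. ?c (k + j)) + (\<Sum>k<j. ?c k)"
      unfolding total_def by (rule suminf_split_initial_segment[OF summ])
    moreover have "0 \<le> (\<Sum>k<j. ?c k)" by (intro sum_nonneg mult_nonneg_nonneg b_nonneg) simp
    ultimately show ?thesis by simp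
  qed
  finally show ?thesis by (simp add: mult_left_mono)
qed

lemma series_split: "series lam \<sigma> = (\<Sum>k<j. term_at lam \<sigma> k) + (\<Sum>k. term_at lam \<sigma> (k + j))"
  unfolding series_def using suminf_split_initial_segment[OF summable_term, of \<sigma> j] by simp

text \<open>Finitely many terms are integrated one by one and the tail is bounded uniformly in
  \<sigma>, so expectation and infinite sum are never interchanged.\<close>

lemma norm_expectation_series_le:
  "norm (expectation (series lam) - (\<Sum>k<j. lam powr \<eta> (Suc k) *\<^sub>R expectation (P (Suc k))))
    \<le> (lam / lam0) powr \<eta> (Suc j) * total"
proof -
  let ?tail = "\<lambda>\<sigma>. \<Sum>k. term_at lam \<sigma> (k + j)"
  have [measurable]: "?tail \<in> borel_measurable p"
    unfolding term_at_def by measurable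
  have it: "integrable p ?tail"
    by (rule integrable_const_bound) (use norm_tail_le in auto)
  have "expectation (series lam) = expectation (\<lambda>\<sigma>. (\<Sum>k<j. term_at lam \<sigma> k) + ?tail \<sigma>)"
    by (simp only: series_split[of _ j, symmetric])
  also have "\<dots> = (\<Sum>k<j. lam powr \<eta> (Suc k) *\<^sub>R expectation (P (Suc k))) + expectation ?tail"
    unfolding term_at_def using it integrable_P
    by (subst Bochner_Integration.integral_add) (simp_all add: term_at_def)
  finally have "norm (expectation (series lam) - (\<Sum>k<j. lam powr \<eta> (Suc k) *\<^sub>R expectation (P (Suc k))))
    = norm (expectation ?tail)" by simp
  also have "\<dots> \<le> (lam / lam0) powr \<eta> (Suc j) * total"
    by (rule norm_integral_le_const) (use norm_tail_le total_nonneg in auto)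
  finally show ?thesis .
qed

end

end

section \<open>Coordinates adapted to the fixed direction\<close>

lemma evec_inner_same [simp]: "evec (\<theta> + \<phi>) \<bullet> evec \<theta> = cos \<phi>"
proof -
  have "evec (\<theta> + \<phi>) \<bullet> evec \<theta> = cos (\<theta> + \<phi> - \<theta>)"
    unfolding cos_diff by (simp add: evec_def inner_vec_def sum_2)
  then show ?thesis by simp
qed

lemma evec_inner_orth [simp]: "evec (\<theta> + \<phi>) \<bullet> evec (\<theta> + pi / 2) = sin \<phi>"
proof -
  have "evec (\<theta> + \<phi>) \<bullet> evec (\<theta> + pi / 2) = sin (\<theta> + \<phi> - \<theta>)"
    unfolding sin_diff by (simp add: evec_def inner_vec_def sum_2 cos_add[of _ "pi / 2"] sin_add[of _ "pi / 2"])
  then show ?thesis by simp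
qed

text \<open>The shear \<open>m\<close> will diagonalise the mean of $P_K$; the dilation \<open>\<kappa>\<close> will make the noise small
  compared with the contraction, so that $1 - \mathrm{Re}\,\zeta$ becomes a Lyapunov function.\<close>
definition frame :: "real \<Rightarrow> real \<Rightarrow> real \<Rightarrow> real^2 \<Rightarrow> complex" where
  "frame \<theta> \<kappa> m v = Complex (\<kappa> * (v \<bullet> evec \<theta> - m * (v \<bullet> evec (\<theta> + pi / 2)))) (v \<bullet> evec (\<theta> + pi / 2))"

lemma linear_frame: "linear (frame \<theta> \<kappa> m)"
  by (intro linearI) (simp_all add: frame_def complex_eq_iff inner_add_left algebra_simps)

lemma evec_decomposition: "v = (v \<bullet> evec \<theta>) *\<^sub>R evec \<theta> + (v \<bullet> evec (\<theta> + pi / 2)) *\<^sub>R evec (\<theta> + pi / 2)"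
proof -
  have *: "cos \<theta> * (cos \<theta> * x) + sin \<theta> * (sin \<theta> * x) = x" for x
    using sin_cos_squared_add2[of \<theta>] by (simp flip: mult.assoc distrib_right add: power2_eq_square)
  show ?thesis
    by (simp only: vec_eq_iff forall_2)
      (simp add: evec_def inner_vec_def sum_2 sin_add cos_add algebra_simps power2_eq_square *)
qed

lemma frame_eq_0_iff: "\<kappa> \<noteq> 0 \<Longrightarrow> frame \<theta> \<kappa> m v = 0 \<longleftrightarrow> v = 0"
  using evec_decomposition[of v \<theta>] by (auto simp: frame_def complex_eq_iff)

text \<open>The frame is a linear isomorphism of the plane, and B' / B bounds its distortion. The
  maximum with 1 lets powers of \<Lambda> be compared later.\<close>

lemma frame_matrix_bound:
  assumes "\<kappa> \<noteq> 0"
  obtains \<Lambda> where "\<Lambda> \<ge> 1" "\<And>X v. norm (frame \<theta> \<kappa> m (X *v v)) \<le> \<Lambda> * norm X * norm (frame \<theta> \<kappa> m v)"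
proof -
  let ?l = "frame \<theta> \<kappa> m"
  have "inj ?l"
    using linear_injective_0[OF linear_frame[of \<theta> \<kappa> m]] frame_eq_0_iff[OF assms] by blast
  then obtain B where B: "B > 0" "\<And>v. B * norm v \<le> norm (?l v)"
    using linear_inj_bounded_below_pos[OF linear_frame[of \<theta> \<kappa> m]] by blast
  obtain B' where B': "B' > 0" "\<And>v. norm (?l v) \<le> B' * norm v"
    using linear_bounded_pos[OF linear_frame[of \<theta> \<kappa> m]] by blast
  show thesis
  proof
    show "max 1 (B' / B) \<ge> 1" by simp
    fix X :: mat2 and v :: "real^2"
    have "norm (?l (X *v v)) \<le> B' * (norm X * norm v)"
      using B' norm_matrix_vector_le[of X v] by (meson less_imp_le mult_left_mono order_trans)
    also have "\<dots> = B' / B * norm X * (B * norm v)" using B by simp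
    also have "\<dots> \<le> max 1 (B' / B) * norm X * norm (?l v)"
      using B B' by (intro mult_mono mult_nonneg_nonneg) auto
    finally show "norm (?l (X *v v)) \<le> max 1 (B' / B) * norm X * norm (?l v)" .
  qed
qed

section \<open>Periodic C^2 functions near the fixed direction\<close>

lemma sin_squared_ge:
  assumes "\<bar>x\<bar> \<le> pi / 2"
  shows "x\<^sup>2 \<le> 9 * (sin x)\<^sup>2"
proof -
  have x2: "\<bar>x\<bar> \<le> 2" using assms pi_less_4 by linarith
  \<comment> \<open>For |x| \<le> 2 the cubic error is at most two thirds of |x|, so |sin x| is at
    least one third of it.\<close>
  have "\<bar>sin x - x\<bar> \<le> \<bar>x\<bar> ^ 3 / 6"
    using Maclaurin_sin_bound[of x 3] by (simp add: numeral_3_eq_3 sin_coeff_def fact_numeral)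
  also have "\<bar>x\<bar> ^ 3 / 6 = \<bar>x\<bar> * \<bar>x\<bar>\<^sup>2 / 6" by (simp add: power2_eq_square power3_eq_cube)
  also have "\<dots> \<le> \<bar>x\<bar> * 2\<^sup>2 / 6"
    using x2 by (intro divide_right_mono mult_left_mono power_mono) auto
  finally have "\<bar>x\<bar> \<le> \<bar>3 * sin x\<bar>" by (simp add: abs_if split: if_splits)
  then have "x\<^sup>2 \<le> (3 * sin x)\<^sup>2" by (rule abs_le_square_iff[THEN iffD1])
  then show ?thesis by (simp add: power_mult_distrib)
qed

lemma C2_periodic_sin_expansion:
  assumes "C2_periodic f"
  obtains d C where "C \<ge> 0" "\<And>\<phi>. \<bar>f (\<theta> + \<phi>) - f \<theta> - d * (sin \<phi> * cos \<phi>)\<bar> \<le> C * (sin \<phi>)\<^sup>2"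
proof -
  from assms obtain f' f'' where per: "\<And>x. f (x + pi) = f x"
    and f': "\<And>x. (f has_real_derivative f' x) (at x)"
    and f'': "\<And>x. (f' has_real_derivative f'' x) (at x)" and cont: "continuous_on UNIV f''"
    unfolding C2_periodic_def by blast
  define d where "d = f' \<theta>"
  \<comment> \<open>The function sin x cos x has period pi and slope 1 at 0. Subtracting d times it
    kills the linear term and keeps the period.\<close>
  define g where "g = (\<lambda>x. f (\<theta> + x) - d * (sin x * cos x))"
  define g' where "g' = (\<lambda>x. f' (\<theta> + x) - d * (cos x * cos x - sin x * sin x))"
  define g'' where "g'' = (\<lambda>x. f'' (\<theta> + x) + 4 * d * (sin x * cos x))"
  have g': "(g has_real_derivative g' x) (at x)" for x
    unfolding g_def g'_def
    by (rule derivative_eq_intros DERIV_chain2[OF f'] refl | simp add: algebra_simps)+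
  have g'': "(g' has_real_derivative g'' x) (at x)" for x
    unfolding g'_def g''_def
    by (rule derivative_eq_intros DERIV_chain2[OF f''] refl | simp add: algebra_simps)+
  \<comment> \<open>Since pi / 2 < 2, this interval contains a full period centred at 0.\<close>
  have "continuous_on {-2..2} g''"
    unfolding g''_def using cont
    by (intro continuous_intros continuous_on_compose2[OF cont]) auto
  then have "bounded (g'' ` {-2..2})"
    by (intro compact_imp_bounded compact_continuous_image) auto
  then obtain B where B: "B > 0" "\<And>x. x \<in> {-2..2} \<Longrightarrow> \<bar>g'' x\<bar> \<le> B"
    unfolding bounded_pos by auto
  have g'_le: "\<bar>g' x\<bar> \<le> B * \<bar>x\<bar>" if "\<bar>x\<bar> \<le> 2" for x
  proof -
    have "norm (g' x - g' 0) \<le> B * norm (x - 0)"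
      by (rule field_differentiable_bound[of "{-2..2}" g' g''])
        (use that B in \<open>auto intro: has_field_derivative_at_within[OF g'']\<close>)
    then show ?thesis by (simp add: g'_def d_def)
  qed
  have g_le: "\<bar>g x - g 0\<bar> \<le> B * x\<^sup>2" if "\<bar>x\<bar> \<le> 2" for x
  proof -
    have "norm (g x - g 0) \<le> (B * \<bar>x\<bar>) * norm (x - 0)"
    proof (rule field_differentiable_bound[of "{-\<bar>x\<bar>..\<bar>x\<bar>}" g g'])
      fix y assume y: "y \<in> {-\<bar>x\<bar>..\<bar>x\<bar>}"
      then have "\<bar>g' y\<bar> \<le> B * \<bar>y\<bar>" using that by (intro g'_le) auto
      also have "\<dots> \<le> B * \<bar>x\<bar>" using B y by (intro mult_left_mono) auto
      finally show "norm (g' y) \<le> B * \<bar>x\<bar>" by simp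
    qed (auto intro: has_field_derivative_at_within[OF g'])
    then show ?thesis by (simp add: power2_eq_square mult.assoc flip: abs_mult)
  qed
  \<comment> \<open>Pairing both functions lets one shift by a multiple of pi treat them together; x
    below is the representative of \<phi> in [-pi/2, pi/2].\<close>
  define k where "k = (\<lambda>x. (g x, (sin x)\<^sup>2))"
  interpret periodic_fun_simple k pi
    by unfold_locales (simp add: k_def g_def per add.assoc[symmetric])
  show thesis
  proof
    show "9 * B \<ge> 0" using B by simp
    fix \<phi>
    define x where "x = \<phi> + of_int (- round (\<phi> / pi)) * pi"
    have "\<bar>\<phi> / pi - of_int (round (\<phi> / pi))\<bar> \<le> 1 / 2"
      using of_int_round_abs_le[of "\<phi> / pi"] by (simp add: abs_minus_commute)
    then have "\<bar>\<phi> / pi - of_int (round (\<phi> / pi))\<bar> * pi \<le> 1 / 2 * pi"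
      by (intro mult_right_mono) auto
    moreover have "\<bar>\<phi> / pi - of_int (round (\<phi> / pi))\<bar> * pi = \<bar>x\<bar>"
    proof -
      have "x = (\<phi> / pi - of_int (round (\<phi> / pi))) * pi" by (simp add: x_def field_simps)
      then show ?thesis by (simp add: abs_mult)
    qed
    ultimately have x: "\<bar>x\<bar> \<le> pi / 2" by simp
    have "k x = k \<phi>" unfolding x_def by (rule plus_of_int)
    then have kx: "g x = g \<phi>" "(sin x)\<^sup>2 = (sin \<phi>)\<^sup>2" by (simp_all add: k_def)
    have "\<bar>g x - g 0\<bar> \<le> B * x\<^sup>2" using x pi_less_4 by (intro g_le) linarith
    also have "\<dots> \<le> B * (9 * (sin x)\<^sup>2)" using B sin_squared_ge[OF x] by simp
    finally show "\<bar>f (\<theta> + \<phi>) - f \<theta> - d * (sin \<phi> * cos \<phi>)\<bar> \<le> 9 * B * (sin \<phi>)\<^sup>2"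
      unfolding kx by (simp add: g_def algebra_simps)
  qed
qed

text \<open>With D the squared length of the frame vector, (1 - Re \<zeta>) / 2 = s^2 / D, and
  \<kappa>/2 times Im \<zeta> equals \<kappa>^2 (c - m s) s / D. Since D = \<kappa>^2 + O(s), this
  agrees with s c up to a multiple of s^2 / D.\<close>

lemma frame_angle_comparison:
  fixes \<kappa> m :: real
  assumes "\<kappa> > 0"
  obtains C where "C \<ge> 0"
    "\<And>\<phi>. \<bar>sin \<phi> * cos \<phi> - \<kappa> / 2 * Im (direction (frame \<theta> \<kappa> m) (evec (\<theta> + \<phi>)))\<bar>
      \<le> C * (1 - Re (direction (frame \<theta> \<kappa> m) (evec (\<theta> + \<phi>))))"
    "\<And>\<phi>. (sin \<phi>)\<^sup>2 \<le> C * (1 - Re (direction (frame \<theta> \<kappa> m) (evec (\<theta> + \<phi>))))"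
proof -
  let ?l = "frame \<theta> \<kappa> m"
  \<comment> \<open>The first bracket bounds D, the second bounds the cofactor r of s^2
    below.\<close>
  define C where "C = (\<kappa>\<^sup>2 * (1 + \<bar>m\<bar>)\<^sup>2 + 1) + (\<kappa>\<^sup>2 * m\<^sup>2 + 1 + \<kappa>\<^sup>2 + 3 * \<kappa>\<^sup>2 * \<bar>m\<bar>)"
  have main: "\<bar>s * c - \<kappa> / 2 * Im \<zeta>\<bar> \<le> C / 2 * (1 - Re \<zeta>) \<and> s\<^sup>2 \<le> C / 2 * (1 - Re \<zeta>)"
    if c: "c = cos \<phi>" and s: "s = sin \<phi>" and \<zeta>: "\<zeta> = direction ?l (evec (\<theta> + \<phi>))" for \<phi> c s \<zeta>
  proof -
    define z where "z = ?l (evec (\<theta> + \<phi>))"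
    define D where "D = (norm z)\<^sup>2"
    have cs: "c\<^sup>2 + s\<^sup>2 = 1" by (simp add: c s)
    have z: "z = Complex (\<kappa> * (c - m * s)) s" by (simp add: z_def frame_def c s)
    have D: "D = \<kappa>\<^sup>2 * (c - m * s)\<^sup>2 + s\<^sup>2" unfolding D_def z cmod_power2 by (simp add: power_mult_distrib)
    have "z \<noteq> 0"
    proof
      assume "z = 0"
      then have "c = 0" "s = 0" using assms by (auto simp: z complex_eq_iff)
      then show False using cs by simp
    qed
    then have D0: "D > 0" by (simp add: D_def)
    have om: "s\<^sup>2 / D = (1 - Re \<zeta>) / 2"
      using Im_squared_direction[of ?l "evec (\<theta> + \<phi>)"] \<open>z \<noteq> 0\<close>
      by (simp add: \<zeta> D_def z_def[symmetric]) (simp add: z)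
    have "\<zeta> = z\<^sup>2 / of_real D" by (simp add: \<zeta> direction_eq D_def z_def)
    then have Im: "Im \<zeta> = 2 * (\<kappa> * (c - m * s)) * s / D" by (simp add: Im_power2 z)
    have c1: "\<bar>c\<bar> \<le> 1" and s1: "\<bar>s\<bar> \<le> 1" by (simp_all add: c s)
    have "\<bar>c - m * s\<bar> \<le> 1 + \<bar>m\<bar> * 1"
      using c1 s1 by (intro order_trans[OF abs_triangle_ineq4] add_mono) (simp_all add: abs_mult mult_left_le)
    then have "(c - m * s)\<^sup>2 \<le> (1 + \<bar>m\<bar>)\<^sup>2" by (intro abs_le_square_iff[THEN iffD1]) simp
    moreover have "s\<^sup>2 \<le> 1" using cs zero_le_power2[of c] by linarith
    ultimately have "D \<le> \<kappa>\<^sup>2 * (1 + \<bar>m\<bar>)\<^sup>2 + 1"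
      unfolding D by (intro add_mono mult_left_mono) auto
    also have "\<dots> \<le> C" by (simp add: C_def)
    finally have DC: "D \<le> C" .
    have "s\<^sup>2 = D * (s\<^sup>2 / D)" using D0 by simp
    also have "\<dots> \<le> C * (s\<^sup>2 / D)" using DC D0 by (intro mult_right_mono) auto
    finally have 1: "s\<^sup>2 \<le> C / 2 * (1 - Re \<zeta>)" by (simp add: om)
    define r where "r = c * ((\<kappa>\<^sup>2 * m\<^sup>2 + 1 - \<kappa>\<^sup>2) * s - 2 * \<kappa>\<^sup>2 * m * c) + \<kappa>\<^sup>2 * m"
    have Dk: "D - \<kappa>\<^sup>2 = s * ((\<kappa>\<^sup>2 * m\<^sup>2 + 1 - \<kappa>\<^sup>2) * s - 2 * \<kappa>\<^sup>2 * m * c)"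
    proof -
      have "D - \<kappa>\<^sup>2 * (c\<^sup>2 + s\<^sup>2) = s * ((\<kappa>\<^sup>2 * m\<^sup>2 + 1 - \<kappa>\<^sup>2) * s - 2 * \<kappa>\<^sup>2 * m * c)"
        unfolding D by (simp add: algebra_simps power2_eq_square)
      then show ?thesis by (simp add: cs)
    qed
    have "s * c * D - \<kappa>\<^sup>2 * (c - m * s) * s = s * (c * (D - \<kappa>\<^sup>2) + \<kappa>\<^sup>2 * m * s)"
      by (simp add: algebra_simps)
    also have "\<dots> = s\<^sup>2 * r" unfolding Dk r_def by (simp add: algebra_simps power2_eq_square)
    finally have num: "s * c * D - \<kappa>\<^sup>2 * (c - m * s) * s = s\<^sup>2 * r" .
    have "s * c - \<kappa> / 2 * Im \<zeta> = (s * c * D - \<kappa>\<^sup>2 * (c - m * s) * s) / D"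
      unfolding Im using D0 by (simp add: diff_divide_distrib power2_eq_square)
    also have "\<dots> = s\<^sup>2 * r / D" by (simp only: num)
    finally have "s * c - \<kappa> / 2 * Im \<zeta> = s\<^sup>2 * r / D" .
    then have "\<bar>s * c - \<kappa> / 2 * Im \<zeta>\<bar> = \<bar>r\<bar> * (s\<^sup>2 / D)"
      using D0 by (simp add: abs_mult)
    also have "\<bar>r\<bar> \<le> C"
    proof -
      have "\<bar>c * (p * s - q * c) + e\<bar> \<le> \<bar>p\<bar> + \<bar>q\<bar> + \<bar>e\<bar>" for p q e
      proof -
        have "\<bar>p * s\<bar> \<le> \<bar>p\<bar>" "\<bar>q * c\<bar> \<le> \<bar>q\<bar>"
          using c1 s1 by (simp_all add: abs_mult mult_left_le)
        then have "\<bar>p * s - q * c\<bar> \<le> \<bar>p\<bar> + \<bar>q\<bar>" by linarith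
        moreover have "\<bar>c * (p * s - q * c)\<bar> \<le> 1 * \<bar>p * s - q * c\<bar>"
          unfolding abs_mult using c1 by (intro mult_right_mono) auto
        ultimately have "\<bar>c * (p * s - q * c)\<bar> \<le> \<bar>p\<bar> + \<bar>q\<bar>" by simp
        then show ?thesis by (intro order_trans[OF abs_triangle_ineq] add_right_mono)
      qed
      then have "\<bar>r\<bar> \<le> \<bar>\<kappa>\<^sup>2 * m\<^sup>2 + 1 - \<kappa>\<^sup>2\<bar> + \<bar>2 * \<kappa>\<^sup>2 * m\<bar> + \<bar>\<kappa>\<^sup>2 * m\<bar>"
        unfolding r_def .
      also have "\<dots> \<le> (\<kappa>\<^sup>2 * m\<^sup>2 + 1 + \<kappa>\<^sup>2) + \<bar>2 * \<kappa>\<^sup>2 * m\<bar> + \<bar>\<kappa>\<^sup>2 * m\<bar>"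
        by (intro add_right_mono) (auto simp: abs_le_iff)
      also have "\<dots> = \<kappa>\<^sup>2 * m\<^sup>2 + 1 + \<kappa>\<^sup>2 + 3 * \<kappa>\<^sup>2 * \<bar>m\<bar>" by (simp add: abs_mult)
      also have "\<dots> \<le> C" by (simp add: C_def)
      finally show ?thesis .
    qed
    then have "\<bar>r\<bar> * (s\<^sup>2 / D) \<le> C * (s\<^sup>2 / D)" using D0 by (intro mult_right_mono) auto
    finally show ?thesis using 1 by (simp add: om)
  qed
  show thesis
  proof
    show "C / 2 \<ge> 0" by (simp add: C_def)
  qed (use main[OF refl refl refl] in blast)+
qed

text \<open>Three replacements are chained: f - f(\<theta>) by d sin cos, this by d \<kappa>/2 Im
  \<zeta>, and this by -c Im D. Each costs a multiple of 1 - Re \<zeta>, which the Lyapunov bound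
  turns into a multiple of Re D.\<close>

lemma C2_periodic_dominated_by_drift:
  assumes f: "C2_periodic f" and "\<kappa> > 0" "A > 0"
  obtains c c' where "c' \<ge> 0"
    "\<And>\<phi>. \<bar>f \<phi> - f \<theta> + c * Im (drift A (direction (frame \<theta> \<kappa> m) (evec \<phi>)))\<bar>
      \<le> c' * Re (drift A (direction (frame \<theta> \<kappa> m) (evec \<phi>)))"
proof -
  let ?dir = "\<lambda>\<phi>. direction (frame \<theta> \<kappa> m) (evec \<phi>)"
  obtain d C1 where C1: "C1 \<ge> 0" "\<And>\<phi>. \<bar>f (\<theta> + \<phi>) - f \<theta> - d * (sin \<phi> * cos \<phi>)\<bar> \<le> C1 * (sin \<phi>)\<^sup>2"
    by (rule C2_periodic_sin_expansion[OF f, of \<theta>]) blast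
  obtain C2 where C2: "C2 \<ge> 0"
    "\<And>\<phi>. \<bar>sin \<phi> * cos \<phi> - \<kappa> / 2 * Im (?dir (\<theta> + \<phi>))\<bar> \<le> C2 * (1 - Re (?dir (\<theta> + \<phi>)))"
    "\<And>\<phi>. (sin \<phi>)\<^sup>2 \<le> C2 * (1 - Re (?dir (\<theta> + \<phi>)))"
    by (rule frame_angle_comparison[OF \<open>\<kappa> > 0\<close>]) blast
  \<comment> \<open>Chosen so that 2 A c = d \<kappa> / 2, because Im D is -2 A Im \<zeta> to first
    order.\<close>
  define c where "c = d * \<kappa> / (4 * A)"
  define C3 where "C3 = C1 * C2 + \<bar>d\<bar> * C2 + \<bar>c\<bar> * (3 * A)"
  have C3: "C3 \<ge> 0" using C1 C2 \<open>A > 0\<close> by (simp add: C3_def)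
  show thesis
  proof
    show "C3 * (2 / A) \<ge> 0" using C3 \<open>A > 0\<close> by simp
    fix \<phi>
    define \<zeta> where "\<zeta> = ?dir \<phi>"
    define u where "u = \<phi> - \<theta>"
    have u: "\<theta> + u = \<phi>" by (simp add: u_def)
    have "evec \<phi> \<noteq> 0"
      using evec_inner_same[of \<phi> 0] by auto
    then have \<zeta>1: "norm \<zeta> = 1"
      using frame_eq_0_iff[of \<kappa> \<theta> m] \<open>\<kappa> > 0\<close> unfolding \<zeta>_def by (intro norm_direction) auto
    have "C1 * (sin u)\<^sup>2 \<le> C1 * (C2 * (1 - Re \<zeta>))"
      using C1(1) C2(3)[of u] by (intro mult_left_mono) (simp_all add: u \<zeta>_def)
    then have 1: "\<bar>f \<phi> - f \<theta> - d * (sin u * cos u)\<bar> \<le> C1 * C2 * (1 - Re \<zeta>)"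
      using C1(2)[of u] by (simp add: u mult.assoc)
    have 2: "\<bar>d * (sin u * cos u) - d * (\<kappa> / 2 * Im \<zeta>)\<bar> \<le> \<bar>d\<bar> * C2 * (1 - Re \<zeta>)"
      unfolding right_diff_distrib[symmetric] abs_mult mult.assoc
      using C2(2)[of u] by (intro mult_left_mono) (simp_all add: u \<zeta>_def)
    have "d * (\<kappa> / 2 * Im \<zeta>) = c * (2 * A * Im \<zeta>)" using \<open>A > 0\<close> by (simp add: c_def)
    moreover have "\<bar>c * (2 * A * Im \<zeta>) + c * Im (drift A \<zeta>)\<bar> \<le> \<bar>c\<bar> * (3 * A) * (1 - Re \<zeta>)"
      unfolding distrib_left[symmetric] abs_mult mult.assoc
      using Im_drift_approx[OF \<zeta>1 \<open>A > 0\<close>] by (intro mult_left_mono) (simp_all add: add.commute mult.assoc)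
    ultimately have "\<bar>f \<phi> - f \<theta> + c * Im (drift A \<zeta>)\<bar>
        \<le> C1 * C2 * (1 - Re \<zeta>) + \<bar>d\<bar> * C2 * (1 - Re \<zeta>) + \<bar>c\<bar> * (3 * A) * (1 - Re \<zeta>)"
      using 1 2 by linarith
    also have "\<dots> = C3 * (2 / A) * (A * (1 - Re \<zeta>) / 2)"
      using \<open>A > 0\<close> by (simp add: C3_def field_simps)
    also have "\<dots> \<le> C3 * (2 / A) * Re (drift A \<zeta>)"
      using C3 \<open>A > 0\<close> Re_drift_ge[OF \<zeta>1 \<open>A > 0\<close>] by (intro mult_left_mono) auto
    finally show "\<bar>f \<phi> - f \<theta> + c * Im (drift A (?dir \<phi>))\<bar> \<le> C3 * (2 / A) * Re (drift A (?dir \<phi>))"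
      by (simp add: \<zeta>_def)
  qed
qed

section \<open>Traceless matrices in a rotated frame\<close>

text \<open>In the orthonormal frame $e_\theta, e_{\theta+\pi/2}$, a traceless matrix has diagonal entries
  $\pm$\<open>diag_coeff\<close>, upper right entry \<open>upper_coeff\<close> and lower left entry \<open>pfun\<close>.\<close>
definition diag_coeff :: "real \<Rightarrow> mat2 \<Rightarrow> real" where
  "diag_coeff \<theta> A = A$1$1 * ((cos \<theta>)\<^sup>2 - (sin \<theta>)\<^sup>2) + (A$1$2 + A$2$1) * (cos \<theta> * sin \<theta>)"

definition upper_coeff :: "real \<Rightarrow> mat2 \<Rightarrow> real" where
  "upper_coeff \<theta> A = A$1$2 * (cos \<theta>)\<^sup>2 - A$2$1 * (sin \<theta>)\<^sup>2 - 2 * A$1$1 * (cos \<theta> * sin \<theta>)"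

text \<open>For traceless A, \<open>pfun A t\<close> is the inner product of A e_t with e_{t+pi/2}.
  Expanding both vectors in the frame at \<theta> exhibits the three matrix entries as
  coefficients.\<close>

lemma pfun_shift:
  "pfun A (\<theta> + \<phi>) = pfun A \<theta> * (cos \<phi>)\<^sup>2 - upper_coeff \<theta> A * (sin \<phi>)\<^sup>2
    - 2 * diag_coeff \<theta> A * (sin \<phi> * cos \<phi>)"
  unfolding pfun_def upper_coeff_def diag_coeff_def sin_double cos_add sin_add
  by (simp add: algebra_simps power2_eq_square)

lemma deriv_pfun: "deriv (pfun A) \<theta> = - 2 * diag_coeff \<theta> A"
proof -
  have "((\<lambda>x. pfun A (\<theta> + (x - \<theta>))) has_real_derivative - 2 * diag_coeff \<theta> A) (at \<theta>)"
    unfolding pfun_shift by (auto intro!: derivative_eq_intros)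
  then show ?thesis by (intro DERIV_imp_deriv) simp
qed

lemma frame_matrix_vector:
  fixes v :: "real^2" and \<theta> :: real
  assumes "sl2 A"
  defines "u \<equiv> v \<bullet> evec \<theta>" and "w \<equiv> v \<bullet> evec (\<theta> + pi / 2)"
  shows "(A *v v) \<bullet> evec \<theta> = diag_coeff \<theta> A * u + upper_coeff \<theta> A * w"
    and "(A *v v) \<bullet> evec (\<theta> + pi / 2) = pfun A \<theta> * u - diag_coeff \<theta> A * w"
proof -
  have v: "v $ 1 = u * cos \<theta> - w * sin \<theta>" "v $ 2 = u * sin \<theta> + w * cos \<theta>"
    using arg_cong[OF evec_decomposition[of v \<theta>], of "\<lambda>x. x $ 1"]
      arg_cong[OF evec_decomposition[of v \<theta>], of "\<lambda>x. x $ 2"]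
    unfolding u_def[symmetric] w_def[symmetric] by (simp_all add: evec_def sin_add cos_add)
  have A: "A $ 2 $ 2 = - A $ 1 $ 1" using assms(1) by (simp add: sl2_def)
  show "(A *v v) \<bullet> evec \<theta> = diag_coeff \<theta> A * u + upper_coeff \<theta> A * w"
    by (simp add: inner_vec_def sum_2 matrix_vector_mult_def v A evec_def diag_coeff_def upper_coeff_def
      algebra_simps power2_eq_square)
  show "(A *v v) \<bullet> evec (\<theta> + pi / 2) = pfun A \<theta> * u - diag_coeff \<theta> A * w"
    unfolding pfun_def sin_double
    by (simp add: inner_vec_def sum_2 matrix_vector_mult_def v A evec_def diag_coeff_def sin_add cos_add
      algebra_simps power2_eq_square)
qed

lemma frame_nilpotent:
  assumes "sl2 A" "pfun A \<theta> = 0" "diag_coeff \<theta> A = 0"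
  shows "frame \<theta> \<kappa> m (A *v v) = of_real (\<kappa> * upper_coeff \<theta> A * Im (frame \<theta> \<kappa> m v))"
  using assms by (simp add: frame_def frame_matrix_vector[where \<theta> = \<theta>] complex_eq_iff)

lemma nilpotent_square:
  assumes "sl2 A" "pfun A \<theta> = 0" "diag_coeff \<theta> A = 0"
  shows "A ** A = 0"
proof -
  have "frame \<theta> 1 0 (A *v (A *v v)) = 0" for v
    using frame_nilpotent[OF assms, of 1 0 "A *v v"] frame_nilpotent[OF assms, of 1 0 v] by simp
  then have "(A ** A) *v v = 0 *v v" for v
    by (simp add: frame_eq_0_iff matrix_vector_mul_assoc)
  then show ?thesis by (simp only: matrix_eq) simp
qed

text \<open>In the rotated frame A is upper triangular with diagonal a, -a. The equation for m is
  the one that makes the shear cancel the upper entry, and diag(a, -a) is a times complex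
  conjugation.\<close>

lemma frame_diagonal:
  assumes "sl2 A" "pfun A \<theta> = 0" and m: "2 * diag_coeff \<theta> A * m = - upper_coeff \<theta> A"
  shows "frame \<theta> \<kappa> m (A *v v) = of_real (diag_coeff \<theta> A) * cnj (frame \<theta> \<kappa> m v)"
proof -
  define a c where "a = diag_coeff \<theta> A" and "c = upper_coeff \<theta> A"
  have c: "c = - (2 * a * m)" using m by (simp add: a_def c_def)
  show ?thesis
    using assms(1,2) by (simp add: frame_def frame_matrix_vector[where \<theta> = \<theta>] complex_eq_iff c algebra_simps
      flip: a_def c_def)
qed

lemma linear_functionals:
  "bounded_linear (diag_coeff \<theta>)" "bounded_linear (upper_coeff \<theta>)" "bounded_linear (\<lambda>A. pfun A \<theta>)"
proof -
  have "linear (diag_coeff \<theta>)" "linear (upper_coeff \<theta>)" "linear (\<lambda>A. pfun A \<theta>)"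
    by (intro linearI; simp add: diag_coeff_def upper_coeff_def pfun_def algebra_simps)+
  then show "bounded_linear (diag_coeff \<theta>)" "bounded_linear (upper_coeff \<theta>)" "bounded_linear (\<lambda>A. pfun A \<theta>)"
    by (simp_all add: linear_conv_bounded_linear)
qed

text \<open>The value at \<theta> is the second moment of \<open>pfun\<close>, so this entry
  vanishes almost surely and the mean becomes a combination of s^4, s^3 c and s^2 c^2 with s, c the
  sine and cosine of t - \<theta>. Its second derivative is then a multiple of the second moment of
  the diagonal entry, which must vanish too.\<close>

lemma (in prob_space) fourth_order_zero:
  fixes P1 :: "'a \<Rightarrow> mat2"
  assumes meas: "P1 \<in> borel_measurable M" and bnd: "\<And>\<sigma>. norm (P1 \<sigma>) \<le> B"
    and zero: "zero_of_order (\<lambda>\<theta>. expectation (\<lambda>\<sigma>. (pfun (P1 \<sigma>) \<theta>)\<^sup>2)) \<theta> 4"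
  shows "AE \<sigma> in M. pfun (P1 \<sigma>) \<theta> = 0 \<and> diag_coeff \<theta> (P1 \<sigma>) = 0"
    and "integrable M (\<lambda>\<sigma>. (upper_coeff \<theta> (P1 \<sigma>))\<^sup>2)"
    and "0 < expectation (\<lambda>\<sigma>. (upper_coeff \<theta> (P1 \<sigma>))\<^sup>2)"
proof -
  define x y z where "x = (\<lambda>\<sigma>. pfun (P1 \<sigma>) \<theta>)" and "y = (\<lambda>\<sigma>. upper_coeff \<theta> (P1 \<sigma>))"
    and "z = (\<lambda>\<sigma>. diag_coeff \<theta> (P1 \<sigma>))"
  define g where "g = (\<lambda>\<phi>. expectation (\<lambda>\<sigma>. (pfun (P1 \<sigma>) \<phi>)\<^sup>2))"
  have int: "integrable M (\<lambda>\<sigma>. h (P1 \<sigma>) * k (P1 \<sigma>))"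
    if h: "bounded_linear h" and k: "bounded_linear k" for h k :: "mat2 \<Rightarrow> real"
  proof -
    obtain H where H: "\<And>X. norm (h X) \<le> norm X * H" using bounded_linear.bounded[OF h] by blast
    obtain J where J: "\<And>X. norm (k X) \<le> norm X * J" using bounded_linear.bounded[OF k] by blast
    have [measurable]: "h \<in> borel_measurable borel" "k \<in> borel_measurable borel" "P1 \<in> borel_measurable M"
      using h k meas by (auto intro: borel_measurable_continuous_onI linear_continuous_on)
    show ?thesis
    proof (rule integrable_const_bound)
      show "AE \<sigma> in M. norm (h (P1 \<sigma>) * k (P1 \<sigma>)) \<le> (B * \<bar>H\<bar>) * (B * \<bar>J\<bar>)"
      proof (rule AE_I2)
        fix \<sigma>
        have "norm X * H' \<le> B * \<bar>H'\<bar>" if "norm X \<le> B" for X :: mat2 and H'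
          using that by (intro order_trans[OF mult_left_mono[OF abs_ge_self] mult_right_mono]) auto
        then have "norm (h (P1 \<sigma>)) \<le> B * \<bar>H\<bar>" "norm (k (P1 \<sigma>)) \<le> B * \<bar>J\<bar>"
          using H[of "P1 \<sigma>"] J[of "P1 \<sigma>"] bnd[of \<sigma>] by (meson order_trans)+
        moreover have "0 \<le> B * \<bar>H\<bar>" using order_trans[OF norm_ge_zero bnd[of \<sigma>]] by simp
        ultimately show "norm (h (P1 \<sigma>) * k (P1 \<sigma>)) \<le> (B * \<bar>H\<bar>) * (B * \<bar>J\<bar>)"
          unfolding norm_mult by (intro mult_mono) auto
      qed
    qed simp
  qed
  note lf = linear_functionals[of \<theta>]
  have ints: "integrable M (\<lambda>\<sigma>. x \<sigma> * x \<sigma>)" "integrable M (\<lambda>\<sigma>. x \<sigma> * y \<sigma>)" "integrable M (\<lambda>\<sigma>. x \<sigma> * z \<sigma>)"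
    "integrable M (\<lambda>\<sigma>. y \<sigma> * y \<sigma>)" "integrable M (\<lambda>\<sigma>. y \<sigma> * z \<sigma>)" "integrable M (\<lambda>\<sigma>. z \<sigma> * z \<sigma>)"
    unfolding x_def y_def z_def by (intro int lf)+
  have square_zero: "AE \<sigma> in M. h \<sigma> = 0"
    if "integrable M (\<lambda>\<sigma>. h \<sigma> * h \<sigma>)" "expectation (\<lambda>\<sigma>. h \<sigma> * h \<sigma>) = 0" for h :: "'a \<Rightarrow> real"
    using integral_nonneg_eq_0_iff_AE[OF that(1)] that(2) by simp
  have d: "(deriv ^^ j) g \<theta> = 0" if "j < 4" for j
    using zero that by (simp add: zero_of_order_def g_def)
  have "expectation (\<lambda>\<sigma>. x \<sigma> * x \<sigma>) = 0"
    using d[of 0] by (simp add: g_def x_def power2_eq_square)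
  then have x0: "AE \<sigma> in M. x \<sigma> = 0" by (rule square_zero[OF ints(1)])
  define kyy kyz kzz where "kyy = expectation (\<lambda>\<sigma>. y \<sigma> * y \<sigma>)" and "kyz = expectation (\<lambda>\<sigma>. y \<sigma> * z \<sigma>)"
    and "kzz = expectation (\<lambda>\<sigma>. z \<sigma> * z \<sigma>)"
  have g: "g = (\<lambda>t. kyy * sin (t - \<theta>) ^ 4 + 4 * kyz * (sin (t - \<theta>) ^ 3 * cos (t - \<theta>))
      + 4 * kzz * (sin (t - \<theta>) ^ 2 * cos (t - \<theta>) ^ 2))"
  proof
    fix t
    define s c where "s = sin (t - \<theta>)" and "c = cos (t - \<theta>)"
    have "g t = expectation (\<lambda>\<sigma>. (pfun (P1 \<sigma>) (\<theta> + (t - \<theta>)))\<^sup>2)" by (simp add: g_def)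
    also have "\<dots> = expectation (\<lambda>\<sigma>. (y \<sigma> * y \<sigma>) * s ^ 4 + (y \<sigma> * z \<sigma>) * (4 * (s ^ 3 * c)) + (z \<sigma> * z \<sigma>) * (4 * (s ^ 2 * c ^ 2)))"
    proof (rule integral_cong_AE)
      show "AE \<sigma> in M. (pfun (P1 \<sigma>) (\<theta> + (t - \<theta>)))\<^sup>2
          = (y \<sigma> * y \<sigma>) * s ^ 4 + (y \<sigma> * z \<sigma>) * (4 * (s ^ 3 * c)) + (z \<sigma> * z \<sigma>) * (4 * (s ^ 2 * c ^ 2))"
        using x0
      proof eventually_elim
        case (elim \<sigma>)
        then show ?case
          unfolding pfun_shift x_def y_def z_def s_def c_def
          by (simp add: algebra_simps power2_eq_square power3_eq_cube power4_eq_xxxx)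
      qed
    next
      show "(\<lambda>\<sigma>. (pfun (P1 \<sigma>) (\<theta> + (t - \<theta>)))\<^sup>2) \<in> borel_measurable M"
        using int[OF linear_functionals(3) linear_functionals(3), of "\<theta> + (t - \<theta>)" "\<theta> + (t - \<theta>)"]
        unfolding power2_eq_square by (rule borel_measurable_integrable)
    qed (use ints in \<open>intro borel_measurable_integrable, simp\<close>)
    also have "\<dots> = kyy * s ^ 4 + kyz * (4 * (s ^ 3 * c)) + kzz * (4 * (s ^ 2 * c ^ 2))"
      using ints by (simp add: kyy_def kyz_def kzz_def)
    finally show "g t = kyy * sin (t - \<theta>) ^ 4 + 4 * kyz * (sin (t - \<theta>) ^ 3 * cos (t - \<theta>))
      + 4 * kzz * (sin (t - \<theta>) ^ 2 * cos (t - \<theta>) ^ 2)" by (simp add: s_def c_def)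
  qed
  define g1 where "g1 = (\<lambda>t. kyy * (4 * sin (t - \<theta>) ^ 3 * cos (t - \<theta>))
    + 4 * kyz * (3 * sin (t - \<theta>) ^ 2 * cos (t - \<theta>) * cos (t - \<theta>) - sin (t - \<theta>) ^ 3 * sin (t - \<theta>))
    + 4 * kzz * (2 * sin (t - \<theta>) * cos (t - \<theta>) ^ 3 - 2 * sin (t - \<theta>) ^ 3 * cos (t - \<theta>)))"
  have "deriv g = g1"
    unfolding g g1_def
    by (intro ext DERIV_imp_deriv)
      (rule derivative_eq_intros refl | simp add: algebra_simps power2_eq_square power3_eq_cube power4_eq_xxxx)+
  \<comment> \<open>At \<theta> the second derivative of s^2 c^2 is 2, and those of s^3 c and s^4
    are 0.\<close>
  moreover have "deriv g1 \<theta> = 8 * kzz"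
    unfolding g1_def
    by (rule DERIV_imp_deriv)
      (rule derivative_eq_intros refl | simp)+
  ultimately have "kzz = 0" using d[of 2] by (simp add: numeral_2_eq_2)
  then have z0: "AE \<sigma> in M. z \<sigma> = 0" unfolding kzz_def by (rule square_zero[OF ints(6)])
  then have "kyz = 0"
    unfolding kyz_def by (subst integral_eq_zero_AE[of "\<lambda>\<sigma>. y \<sigma> * z \<sigma>"]) auto
  \<comment> \<open>Otherwise the mean would vanish identically, and so would its fourth
    derivative.\<close>
  have "kyy \<noteq> 0"
  proof
    assume "kyy = 0"
    then have "g = (\<lambda>_. 0)" using \<open>kyz = 0\<close> \<open>kzz = 0\<close> by (simp add: g)
    then have "(deriv ^^ j) g = (\<lambda>_. 0)" for j by (induction j) auto
    then show False using zero by (simp add: zero_of_order_def g_def)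
  qed
  moreover have "kyy \<ge> 0" unfolding kyy_def by simp
  ultimately have "0 < kyy" by simp
  then show "0 < expectation (\<lambda>\<sigma>. (upper_coeff \<theta> (P1 \<sigma>))\<^sup>2)"
    by (simp add: kyy_def y_def power2_eq_square)
  show "integrable M (\<lambda>\<sigma>. (upper_coeff \<theta> (P1 \<sigma>))\<^sup>2)"
    using ints(4) by (simp add: y_def power2_eq_square)
  show "AE \<sigma> in M. pfun (P1 \<sigma>) \<theta> = 0 \<and> diag_coeff \<theta> (P1 \<sigma>) = 0"
    using x0 z0 by (simp add: x_def z_def)
qed

section \<open>The angle orbit and the linear orbit\<close>

lemma norm_evec [simp]: "norm (evec \<theta>) = 1"
  by (simp add: norm_vec_def L2_set_def sum_2 evec_def)

lemma evec_nonzero [simp]: "evec \<theta> \<noteq> 0"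
  using norm_evec[of \<theta>] by (metis norm_zero zero_neq_one)

lemma evec_parallel_imp_sin_diff:
  assumes "evec \<theta> = r *\<^sub>R evec \<phi>"
  shows "sin (\<theta> - \<phi>) = 0"
proof -
  have "cos \<theta> = r * cos \<phi>" "sin \<theta> = r * sin \<phi>"
    using arg_cong[OF assms, of "\<lambda>x. x $ 1"] arg_cong[OF assms, of "\<lambda>x. x $ 2"] by (simp_all add: evec_def)
  then show ?thesis by (simp add: sin_diff)
qed

text \<open>Parallel unit vectors have angles differing by a multiple of pi, so a pi-periodic f is a
  function of the line alone.\<close>

lemma periodic_evec_parallel:
  assumes "\<And>x. f (x + pi) = f x" and "evec \<theta> = r *\<^sub>R evec \<phi>"
  shows "f \<theta> = f \<phi>"
proof -
  interpret periodic_fun_simple f pi by unfold_locales (rule assms(1))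
  obtain i :: int where "\<theta> - \<phi> = of_int i * pi"
    using evec_parallel_imp_sin_diff[OF assms(2)] sin_zero_iff_int2 by blast
  then have "\<theta> = \<phi> + of_int i * pi" by simp
  then show ?thesis using plus_of_int by metis
qed

lemma evec_angle_map:
  assumes "T *v evec \<theta> \<noteq> 0"
  obtains r where "r \<noteq> 0" "evec (angle_map T \<theta>) = r *\<^sub>R (T *v evec \<theta>)"
proof -
  define n where "n = norm (T *v evec \<theta>)"
  define v where "v = (1 / n) *\<^sub>R (T *v evec \<theta>)"
  define P where "P = (\<lambda>\<phi>. 0 \<le> \<phi> \<and> \<phi> < pi \<and> (evec \<phi> = v \<or> evec \<phi> = - v))"
  have n: "n \<noteq> 0" using assms by (simp add: n_def)
  have "norm v = 1" using n by (simp add: v_def n_def)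
  then have "(v $ 1)\<^sup>2 + (v $ 2)\<^sup>2 = 1"
    by (simp add: norm_vec_def L2_set_def sum_2)
  then obtain t where t: "0 \<le> t" "t < 2 * pi" "v $ 1 = cos t" "v $ 2 = sin t"
    using sincos_total_2pi by metis
  have vt: "v = evec t"
    using t by (simp add: vec_eq_iff forall_2 evec_def)
  have ex: "\<exists>\<phi>. P \<phi>"
  proof (cases "t < pi")
    case True then show ?thesis using t vt by (auto simp: P_def)
  next
    case False
    have "evec (t - pi) = - v" by (simp add: vt vec_eq_iff forall_2 evec_def)
    then show ?thesis using False t by (intro exI[of _ "t - pi"]) (simp add: P_def)
  qed
  have uniq: "\<phi> = \<psi>" if "P \<phi>" "P \<psi>" for \<phi> \<psi>
  proof -
    have "evec \<phi> = 1 *\<^sub>R evec \<psi> \<or> evec \<phi> = (- 1) *\<^sub>R evec \<psi>"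
      using that by (auto simp: P_def)
    then have "sin (\<phi> - \<psi>) = 0" by (elim disjE) (rule evec_parallel_imp_sin_diff, assumption)+
    moreover have "0 \<le> \<phi>" "\<phi> < pi" "0 \<le> \<psi>" "\<psi> < pi" using that by (simp_all only: P_def)
    then have "- pi < \<phi> - \<psi>" "\<phi> - \<psi> < pi" by linarith+
    ultimately have "\<phi> - \<psi> = 0" by (metis sin_eq_0_pi)
    then show ?thesis by simp
  qed
  have "angle_map T \<theta> = (THE \<phi>. P \<phi>)"
    by (simp add: angle_map_def Let_def P_def v_def n_def)
  moreover have "P (THE \<phi>. P \<phi>)" by (rule theI') (use ex uniq in blast)
  ultimately have "evec (angle_map T \<theta>) = v \<or> evec (angle_map T \<theta>) = - v"
    by (simp add: P_def)
  then show thesis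
    using that[of "1 / n"] that[of "- (1 / n)"] n unfolding v_def by (elim disjE) simp_all
qed

text \<open>The value \<open>pi\<close> on the whole closed half-line, instead of \<open>Arg 0 = 0\<close> at the origin, makes the
  function piecewise continuous and hence measurable.\<close>
definition angle_of :: "real^2 \<Rightarrow> real" where
  "angle_of v = (let z = Complex (v $ 1) (v $ 2) in if z \<in> \<real>\<^sub>\<le>\<^sub>0 then pi else Arg z)"

lemma angle_of_measurable [measurable]: "angle_of \<in> borel_measurable borel"
proof -
  have [measurable]: "(\<lambda>z. if z \<in> \<real>\<^sub>\<le>\<^sub>0 then pi else Arg z) \<in> borel_measurable borel"
    by (intro borel_measurable_continuous_on_if continuous_intros) auto
  have [measurable]: "(\<lambda>v::real^2. Complex (v $ 1) (v $ 2)) \<in> borel_measurable borel"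
    unfolding complex_eq by (intro borel_measurable_continuous_onI continuous_intros)
  show ?thesis unfolding angle_of_def[abs_def] Let_def by measurable
qed

lemma evec_angle_of:
  assumes "v \<noteq> 0"
  obtains r where "r > 0" "v = r *\<^sub>R evec (angle_of v)"
proof -
  define z where "z = Complex (v $ 1) (v $ 2)"
  have "z \<noteq> 0" using assms by (auto simp: z_def complex_eq_iff vec_eq_iff forall_2)
  \<comment> \<open>Off the origin the special value agrees with \<open>Arg\<close>, which is pi on
    the negative axis.\<close>
  have "angle_of v = Arg z"
  proof (cases "z \<in> \<real>\<^sub>\<le>\<^sub>0")
    case True
    then obtain x where "z = of_real x" "x \<le> 0" by (auto elim: nonpos_Reals_cases)
    then have "Arg z = pi" using \<open>z \<noteq> 0\<close> by (simp add: Arg_of_real)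
    then show ?thesis using True by (simp add: angle_of_def z_def Let_def)
  qed (simp add: angle_of_def z_def Let_def)
  moreover have "z = of_real (norm z) * cis (Arg z)"
    using rcis_cmod_Arg[of z] by (simp add: rcis_def)
  then have "v $ 1 = norm z * cos (Arg z)" "v $ 2 = norm z * sin (Arg z)"
    by (simp_all add: complex_eq_iff z_def)
  ultimately have "v = norm z *\<^sub>R evec (angle_of v)"
    by (simp add: vec_eq_iff forall_2 evec_def)
  moreover have "norm z > 0" using \<open>z \<noteq> 0\<close> by simp
  ultimately show thesis by (intro that)
qed

lemma matrix_vector_nonzero:
  fixes A :: "real^'n^'n"
  assumes "det A \<noteq> 0" "v \<noteq> 0"
  shows "A *v v \<noteq> 0"
proof
  assume "A *v v = 0"
  obtain A' where "A' ** A = mat 1"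
    using assms(1) invertible_det_nz[of A] by (auto simp: invertible_def)
  then have "v = A' *v (A *v v)" by (simp add: matrix_vector_mul_assoc)
  then show False using \<open>A *v v = 0\<close> assms(2) by simp
qed

text \<open>The angle orbit and the linear orbit span the same line at all times. The nonzero factor
  r absorbs the normalisations and the signs, both of which may depend on \<omega>.\<close>

lemma evec_orbit:
  fixes B X :: "'s \<Rightarrow> mat2"
  assumes BX: "\<And>\<sigma>. B \<sigma> = X \<sigma> \<or> B \<sigma> = - X \<sigma>" and det: "\<And>\<sigma>. det (B \<sigma>) \<noteq> 0"
  obtains r where "r \<noteq> 0"
    "evec (orbit (\<lambda>\<sigma>. angle_map (B \<sigma>)) \<theta>0 \<omega> n) = r *\<^sub>R path (\<lambda>\<sigma> v. X \<sigma> *v v) (evec \<theta>0) \<omega> n"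
proof -
  have "\<exists>r. r \<noteq> 0 \<and>
    evec (orbit (\<lambda>\<sigma>. angle_map (B \<sigma>)) \<theta>0 \<omega> n) = r *\<^sub>R path (\<lambda>\<sigma> v. X \<sigma> *v v) (evec \<theta>0) \<omega> n"
  proof (induction n)
    case 0 show ?case by (intro exI[of _ 1]) simp
  next
    case (Suc n)
    let ?\<theta> = "orbit (\<lambda>\<sigma>. angle_map (B \<sigma>)) \<theta>0 \<omega> n" and ?v = "path (\<lambda>\<sigma> v. X \<sigma> *v v) (evec \<theta>0) \<omega> n"
    obtain r where r: "r \<noteq> 0" "evec ?\<theta> = r *\<^sub>R ?v" using Suc by blast
    have "B (\<omega> n) *v evec ?\<theta> \<noteq> 0"
      by (rule matrix_vector_nonzero[OF det evec_nonzero])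
    then obtain r' where r': "r' \<noteq> 0" "evec (angle_map (B (\<omega> n)) ?\<theta>) = r' *\<^sub>R (B (\<omega> n) *v evec ?\<theta>)"
      by (rule evec_angle_map)
    obtain e where e: "e \<noteq> 0" "B (\<omega> n) *v evec ?\<theta> = e *\<^sub>R (X (\<omega> n) *v evec ?\<theta>)"
    proof (cases "B (\<omega> n) = X (\<omega> n)")
      case True then show thesis using that[of 1] by simp
    next
      case False
      then have "B (\<omega> n) = - X (\<omega> n)" using BX by blast
      then have "B (\<omega> n) *v evec ?\<theta> = (- 1) *\<^sub>R (X (\<omega> n) *v evec ?\<theta>)"
        by (simp add: vec_eq_iff matrix_vector_mult_def sum_negf)
      then show thesis using that[of "- 1"] by simp
    qed
    have "evec (orbit (\<lambda>\<sigma>. angle_map (B \<sigma>)) \<theta>0 \<omega> (Suc n)) = r' *\<^sub>R e *\<^sub>R (X (\<omega> n) *v (r *\<^sub>R ?v))"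
      using r r' e by simp
    also have "\<dots> = (r' * e * r) *\<^sub>R path (\<lambda>\<sigma> v. X \<sigma> *v v) (evec \<theta>0) \<omega> (Suc n)"
      by (simp add: matrix_vector_mult_scaleR)
    finally show ?case using r r' e by (intro exI[of _ "r' * e * r"]) simp
  qed
  then show thesis using that by blast
qed

section \<open>The averaging theorem\<close>

lemma mexp_step_measurable:
  fixes X :: "'s \<Rightarrow> mat2"
  assumes [measurable]: "X \<in> borel_measurable p"
  shows "(\<lambda>(\<sigma>, v). mexp (X \<sigma>) *v v) \<in> borel_measurable (p \<Otimes>\<^sub>M borel)"
proof -
  have "continuous_on UNIV (\<lambda>z :: mat2 \<times> (real^2). fst z *v snd z)"
    unfolding matrix_vector_mult_def by (intro continuous_intros)
  then have [measurable]: "(\<lambda>z :: mat2 \<times> (real^2). fst z *v snd z) \<in> borel_measurable borel"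
    by (rule borel_measurable_continuous_onI)
  have "(\<lambda>x. (mexp (X (fst x)), snd x)) \<in> borel_measurable (p \<Otimes>\<^sub>M (borel :: (real^2) measure))"
    by (rule borel_measurable_Pair) measurable
  from measurable_compose[OF this \<open>(\<lambda>z. fst z *v snd z) \<in> borel_measurable borel\<close>]
  show ?thesis by (simp add: case_prod_beta')
qed

theorem theorem4:
  fixes p :: "'s measure"
    and T :: "real \<Rightarrow> 's \<Rightarrow> mat2"
    and M :: mat2
    and P :: "nat \<Rightarrow> 's \<Rightarrow> mat2"
    and \<eta> :: "nat \<Rightarrow> real"
    and K :: nat
    and lam0 :: real
    and b :: "nat \<Rightarrow> real"
    and \<theta>hat \<theta>0 :: real
    and f :: "real \<Rightarrow> real"
  assumes prob: "prob_space p"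
    and detM: "det M = 1"
    and detT: "\<And>lam \<sigma>. det (T lam \<sigma>) = 1"
    and Psl2: "\<And>k \<sigma>. k \<ge> 1 \<Longrightarrow> sl2 (P k \<sigma>)"
    and Pmeas: "\<And>k. k \<ge> 1 \<Longrightarrow> P k \<in> borel_measurable p"
    and Pbound: "\<And>k \<sigma>. k \<ge> 1 \<Longrightarrow> norm (P k \<sigma>) \<le> b k"
    and lam0: "lam0 > 0"
    and summ: "summable (\<lambda>k. lam0 powr \<eta> (Suc k) * b (Suc k))"
    and eta_pos: "\<eta> 1 > 0"
    and eta_mono: "\<And>k. k \<ge> 1 \<Longrightarrow> \<eta> k < \<eta> (Suc k)"
    and expansion: "\<And>lam \<sigma>. 0 < lam \<Longrightarrow> lam \<le> lam0 \<Longrightarrow>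
        M ** T lam \<sigma> ** matrix_inv M = mexp (\<Sum>k. lam powr \<eta> (Suc k) *\<^sub>R P (Suc k) \<sigma>)
      \<or> M ** T lam \<sigma> ** matrix_inv M = - mexp (\<Sum>k. lam powr \<eta> (Suc k) *\<^sub>R P (Suc k) \<sigma>)"
    and K1: "K \<ge> 1"
    and etaK: "\<eta> K = 2 * \<eta> 1"
    and etaK1: "\<eta> (Suc K) \<le> \<eta> 1 + \<eta> 2"
    and nondeg: "\<And>k. 1 \<le> k \<Longrightarrow> k < K \<Longrightarrow> measure p {\<sigma> \<in> space p. P k \<sigma> = 0} < 1"
    and anomaly: "\<And>k. 1 \<le> k \<Longrightarrow> k < K \<Longrightarrow> (\<integral>\<sigma>. P k \<sigma> \<partial>p) = 0"
    and zero4: "zero_of_order (\<lambda>\<theta>. \<integral>\<sigma>. (pfun (P 1 \<sigma>) \<theta>)^2 \<partial>p) \<theta>hat 4"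
    and zero1: "zero_of_order (\<lambda>\<theta>. \<integral>\<sigma>. pfun (P K \<sigma>) \<theta> \<partial>p) \<theta>hat 1"
    and derivneg: "(\<integral>\<sigma>. deriv (pfun (P K \<sigma>)) \<theta>hat \<partial>p) < 0"
    and Ktilde_ex: "\<exists>k>K. (\<integral>\<sigma>. P k \<sigma> \<partial>p) \<noteq> 0"
    and f: "C2_periodic f"
  shows "\<exists>C lam1. lam1 > 0 \<and> (\<forall>lam N. 0 < lam \<and> lam < lam1 \<and> N \<ge> 1 \<longrightarrow>
     \<bar>I_N p (\<lambda>\<sigma>. angle_map (M ** T lam \<sigma> ** matrix_inv M)) \<theta>0 N f - f \<theta>hat\<bar>
       \<le> C * (lam powr (min (\<eta> (LEAST k. k > K \<and> (\<integral>\<sigma>. P k \<sigma> \<partial>p) \<noteq> 0)) (\<eta> 1 + \<eta> 2) - \<eta> K)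
              + 1 / (lam powr \<eta> K * real N)))"
proof -
  interpret generator_series p P \<eta> b lam0
    using prob Pmeas Pbound lam0 summ eta_mono
    by (intro generator_series.intro generator_series_axioms.intro) auto
  define Kt where "Kt = (LEAST k. k > K \<and> (\<integral>\<sigma>. P k \<sigma> \<partial>p) \<noteq> 0)"
  define mn where "mn = min (\<eta> Kt) (\<eta> 1 + \<eta> 2)"
  have Kt: "Kt > K"
    using LeastI_ex[OF Ktilde_ex] by (simp add: Kt_def)
  have EP0: "expectation (P k) = 0" if "K < k" "k < Kt" for k
    using not_less_Least[of k "\<lambda>k. k > K \<and> (\<integral>\<sigma>. P k \<sigma> \<partial>p) \<noteq> 0"] that by (auto simp: Kt_def)
  \<comment> \<open>K = 1 would force \<eta>_1 = 2 \<eta>_1. Hence \<eta>_2 \<le> \<eta>_K = 2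
    \<eta>_1, and cubic terms are no worse than order \<eta>_1 + \<eta>_2.\<close>
  have K2: "K \<ge> 2"
  proof -
    have "K \<noteq> 1" using etaK eta_pos by auto
    then show ?thesis using K1 by simp
  qed
  then have eta2: "\<eta> 1 + \<eta> 2 \<le> 3 * \<eta> 1"
    using eta_le[of 2 K] etaK by simp
  have eta12: "\<eta> 1 < \<eta> 2" using eta_less[of 1 2] by simp

  define R where "R = expectation (P K)"
  have intPK: "integrable p (P K)" using integrable_P[of "K - 1"] K1 by simp
  have sl2R: "sl2 R"
  proof -
    have "linear (\<lambda>A::mat2. A $ 1 $ 1 + A $ 2 $ 2)" by (intro linearI) (simp_all add: algebra_simps)
    then have "bounded_linear (\<lambda>A::mat2. A $ 1 $ 1 + A $ 2 $ 2)" by (simp add: linear_conv_bounded_linear)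
    from integral_bounded_linear[OF this intPK] show ?thesis
      using Psl2[OF K1] by (simp add: R_def sl2_def)
  qed
  define A where "A = diag_coeff \<theta>hat R"
  have pR: "pfun R \<theta>hat = 0"
  proof -
    have "expectation (\<lambda>\<sigma>. pfun (P K \<sigma>) \<theta>hat) = 0"
      using zero1 unfolding zero_of_order_def by (metis funpow_0 less_numeral_extra(1))
    then show ?thesis
      using integral_bounded_linear[OF linear_functionals(3)[of \<theta>hat] intPK] by (simp add: R_def)
  qed
  \<comment> \<open>The derivative of \<open>pfun\<close> is -2 times the diagonal entry, so the
    negative sign says that the fixed direction is the expanding eigendirection of the mean, hence
    attracting for lines.\<close>
  have A: "A > 0"
    using derivneg integral_bounded_linear[OF linear_functionals(1)[of \<theta>hat] intPK]
    by (simp add: deriv_pfun A_def R_def)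

  have P1: "P 1 \<in> borel_measurable p" "\<And>\<sigma>. norm (P 1 \<sigma>) \<le> b 1"
    using Pmeas Pbound by auto
  note zero = fourth_order_zero[OF P1 zero4]
  define U where "U = expectation (\<lambda>\<sigma>. (upper_coeff \<theta>hat (P 1 \<sigma>))\<^sup>2)"
  have U: "U > 0" using zero(3) by (simp add: U_def)
  \<comment> \<open>Solves \<kappa>^2 U = A / 2, the variance built into \<open>drift\<close>; m
    below solves the equation of \<open>frame_diagonal\<close>.\<close>
  define \<kappa> where "\<kappa> = sqrt (A / (2 * U))"
  have \<kappa>: "\<kappa> > 0" using A U by (simp add: \<kappa>_def)
  define m where "m = - upper_coeff \<theta>hat R / (2 * A)"
  define l where "l = frame \<theta>hat \<kappa> m"
  define \<beta> where "\<beta> = (\<lambda>\<sigma>. \<kappa> * upper_coeff \<theta>hat (P 1 \<sigma>))"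
  have \<beta>: "integrable p (\<lambda>\<sigma>. (\<beta> \<sigma>)\<^sup>2)" "expectation (\<lambda>\<sigma>. (\<beta> \<sigma>)\<^sup>2) = A / 2"
  proof -
    show "integrable p (\<lambda>\<sigma>. (\<beta> \<sigma>)\<^sup>2)"
      using zero(2) by (simp add: \<beta>_def power_mult_distrib)
    have "expectation (\<lambda>\<sigma>. (\<beta> \<sigma>)\<^sup>2) = \<kappa>\<^sup>2 * U"
      by (simp add: \<beta>_def power_mult_distrib U_def)
    also have "\<kappa>\<^sup>2 = A / (2 * U)" using A U by (simp add: \<kappa>_def)
    finally show "expectation (\<lambda>\<sigma>. (\<beta> \<sigma>)\<^sup>2) = A / 2" using U by simp
  qed
  have lR: "l (R *v v) = of_real A * cnj (l v)" for v
    unfolding l_def A_def by (rule frame_diagonal[OF sl2R pR]) (use A in \<open>simp add: m_def A_def\<close>)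
  have lin: "linear l" unfolding l_def by (rule linear_frame)
  obtain \<Lambda> where \<Lambda>: "\<Lambda> \<ge> 1" "\<And>X v. norm (l (X *v v)) \<le> \<Lambda> * norm X * norm (l v)"
    using frame_matrix_bound[of \<kappa> \<theta>hat m] \<kappa> unfolding l_def by blast

  obtain c c' where c: "c' \<ge> 0"
    "\<And>\<phi>. \<bar>f \<phi> - f \<theta>hat + c * Im (drift A (direction l (evec \<phi>)))\<bar> \<le> c' * Re (drift A (direction l (evec \<phi>)))"
    using C2_periodic_dominated_by_drift[OF f \<kappa> A, of \<theta>hat m] unfolding l_def by blast
  have per: "f (x + pi) = f x" for x using f by (simp add: C2_periodic_def)
  \<comment> \<open>f read as a function on the plane. With this value at the origin, where D = 0,
    the domination holds there trivially.\<close>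
  define h where "h = (\<lambda>v. if v = 0 then f \<theta>hat else f (angle_of v))"
  define D where "D = (\<lambda>v. drift A (direction l v))"
  have h_evec: "h v = f \<phi>" if "evec \<phi> = r *\<^sub>R v" "r \<noteq> 0" for v \<phi> r
  proof -
    have v: "v \<noteq> 0" using that evec_nonzero[of \<phi>] by auto
    then obtain r' where "v = r' *\<^sub>R evec (angle_of v)" using evec_angle_of by blast
    then have "evec \<phi> = (r * r') *\<^sub>R evec (angle_of v)" using that by (metis scaleR_scaleR)
    then have "f \<phi> = f (angle_of v)" by (rule periodic_evec_parallel[of f, OF per])
    then show ?thesis using v by (simp add: h_def)
  qed
  have dom: "\<bar>h v - f \<theta>hat + c * Im (D v)\<bar> \<le> c' * Re (D v)" for v
  proof (cases "v = 0")
    case True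
    then show ?thesis by (simp add: h_def D_def drift_def direction_def linear_0[OF lin])
  next
    case False
    then obtain r where r: "r > 0" "v = r *\<^sub>R evec (angle_of v)" using evec_angle_of by blast
    have "direction l v = direction l (r *\<^sub>R evec (angle_of v))" using r(2) by simp
    also have "\<dots> = direction l (evec (angle_of v))"
      using r(1) by (simp add: direction_def linear_scale[OF lin] scaleR_conv_of_real[where 'a = complex])
    finally show ?thesis using c(2)[of "angle_of v"] False by (simp add: D_def h_def)
  qed
  note direction_measurable[OF lin, measurable]
  have D: "D \<in> borel_measurable borel" "norm (D v) \<le> 3 * \<bar>A\<bar>" for v
    unfolding D_def by (measurable, rule norm_drift_le[OF norm_direction_le])
  have h: "h \<in> borel_measurable borel" "norm (h v) \<le> \<bar>f \<theta>hat\<bar> + (\<bar>c\<bar> + c') * (3 * \<bar>A\<bar>)" for v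
  proof -
    have "continuous_on UNIV f"
      using f unfolding C2_periodic_def by (meson DERIV_isCont continuous_at_imp_continuous_on)
    then have [measurable]: "f \<in> borel_measurable borel" by (rule borel_measurable_continuous_onI)
    show "h \<in> borel_measurable borel" unfolding h_def by measurable
    \<comment> \<open>The bound for h is read off from the domination by the bounded function
      D.\<close>
    have "\<bar>c * Im (D v)\<bar> \<le> \<bar>c\<bar> * (3 * \<bar>A\<bar>)"
      unfolding abs_mult by (intro mult_left_mono order_trans[OF abs_Im_le_cmod D(2)]) simp
    moreover have "c' * Re (D v) \<le> c' * (3 * \<bar>A\<bar>)"
      by (intro mult_left_mono order_trans[OF complex_Re_le_cmod D(2)] c(1))
    moreover have "(\<bar>c\<bar> + c') * (3 * \<bar>A\<bar>) = \<bar>c\<bar> * (3 * \<bar>A\<bar>) + c' * (3 * \<bar>A\<bar>)"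
      by (simp add: algebra_simps)
    ultimately show "norm (h v) \<le> \<bar>f \<theta>hat\<bar> + (\<bar>c\<bar> + c') * (3 * \<bar>A\<bar>)"
      using dom[of v] unfolding real_norm_def by linarith
  qed

  \<comment> \<open>The power makes 8 \<Lambda> s \<le> 1 below, with \<open>total + 1\<close>
    keeping the quotient meaningful when \<open>total\<close> is 0; lam \<le> 1 makes larger
    exponents give smaller powers.\<close>
  define lam1 where "lam1 = min (min lam0 1) (lam0 * (1 / (8 * \<Lambda> * (total + 1))) powr (1 / \<eta> 1))"
  have lam1: "lam1 > 0" using lam0 \<Lambda>(1) total_nonneg by (auto simp: lam1_def)
  \<comment> \<open>The summands come from s t, s^3 and w in \<open>expected_direction_step\<close>;
    the powers of \<open>lam0\<close> convert lam / lam0 into lam.\<close>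
  define C0 where "C0 = 300 * \<Lambda> ^ 3 * (total\<^sup>2 / lam0 powr (\<eta> 1 + \<eta> 2) + total ^ 3 / lam0 powr (3 * \<eta> 1))
    + 2 * \<Lambda> * (total / lam0 powr \<eta> Kt)"
  have C0: "C0 \<ge> 0" using \<Lambda>(1) total_nonneg by (simp add: C0_def)
  \<comment> \<open>The 2 is the boundary term of the telescoping, as |\<zeta>| \<le> 1.\<close>
  define C where "C = (\<bar>c\<bar> + c') * (C0 + 2)"
  have main: "\<bar>I_N p (\<lambda>\<sigma>. angle_map (M ** T lam \<sigma> ** matrix_inv M)) \<theta>0 N f - f \<theta>hat\<bar>
      \<le> C * (lam powr (mn - \<eta> K) + 1 / (lam powr \<eta> K * real N))"
    if lam: "0 < lam" "lam < lam1" and N: "N \<ge> 1" for lam N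
  proof -
    have lam': "lam \<le> lam0" "lam \<le> 1" using lam(2) by (simp_all add: lam1_def)
    define x where "x = lam / lam0"
    have x: "0 < x" "x \<le> 1" using lam lam' lam0 by (simp_all add: x_def)
    have x_powr: "x powr a = lam powr a / lam0 powr a" for a
      using lam lam0 by (simp add: x_def powr_divide)
    define s t w e where "s = x powr \<eta> 1 * total" and "t = x powr \<eta> 2 * total"
      and "w = x powr \<eta> Kt * total" and "e = lam powr \<eta> 1"
    have e: "e > 0" "e\<^sup>2 = lam powr \<eta> K"
      using lam by (simp_all add: e_def etaK power2_eq_square flip: powr_add)
    have s: "8 * \<Lambda> * s \<le> 1"
    proof -
      have "x < (1 / (8 * \<Lambda> * (total + 1))) powr (1 / \<eta> 1)"
        using lam(2) lam0 by (simp add: lam1_def x_def divide_less_eq mult.commute)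
      then have "x powr \<eta> 1 \<le> ((1 / (8 * \<Lambda> * (total + 1))) powr (1 / \<eta> 1)) powr \<eta> 1"
        using x eta_pos by (intro powr_mono2) auto
      also have "\<dots> = 1 / (8 * \<Lambda> * (total + 1))"
        using eta_pos \<Lambda>(1) total_nonneg by (simp add: powr_powr)
      finally have "x powr \<eta> 1 \<le> 1 / (8 * \<Lambda> * (total + 1))" .
      moreover have "0 < 8 * \<Lambda> * (total + 1)" using \<Lambda>(1) total_nonneg by simp
      ultimately have "x powr \<eta> 1 * (8 * \<Lambda> * (total + 1)) \<le> 1"
        by (simp only: pos_le_divide_eq)
      moreover have "x powr \<eta> 1 * (8 * \<Lambda> * total) \<le> x powr \<eta> 1 * (8 * \<Lambda> * (total + 1))"
        using \<Lambda>(1) by (intro mult_left_mono) auto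
      ultimately have "x powr \<eta> 1 * (8 * \<Lambda> * total) \<le> 1" by (rule order_trans[rotated])
      then show ?thesis by (simp add: s_def mult_ac)
    qed
    define X Q Y where "X = series lam" and "Q = (\<lambda>\<sigma>. e *\<^sub>R P 1 \<sigma>)"
      and "Y = (\<lambda>\<sigma>. \<Sum>k. term_at lam \<sigma> (k + 1))"
    have X [measurable]: "X \<in> borel_measurable p"
      unfolding X_def by (rule series_measurable)
    have XQY: "X \<sigma> = Q \<sigma> + Y \<sigma>" for \<sigma>
      using series_split[OF lam(1) lam'(1), of \<sigma> 1] by (simp add: X_def Q_def Y_def term_at_def e_def)
    have Qs: "norm (Q \<sigma>) \<le> s" for \<sigma>
    proof -
      have "norm (term_at lam \<sigma> 0) \<le> x powr \<eta> 1 * (lam0 powr \<eta> 1 * b 1)"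
        using norm_term_le[OF lam(1) lam'(1), of 0 0 \<sigma>] by (simp add: x_def)
      also have "\<dots> \<le> s"
      proof -
        have "(\<Sum>k\<in>{0}. lam0 powr \<eta> (Suc k) * b (Suc k)) \<le> total"
          unfolding total_def by (rule sum_le_suminf[OF summ]) (auto intro: mult_nonneg_nonneg b_nonneg)
        then show ?thesis unfolding s_def by (intro mult_left_mono) auto
      qed
      finally show ?thesis by (simp add: Q_def term_at_def e_def)
    qed
    have Yt: "norm (Y \<sigma>) \<le> t" for \<sigma>
      using norm_tail_le[OF lam(1) lam'(1), of \<sigma> 1] by (simp add: Y_def t_def x_def numeral_2_eq_2)
    have ts: "t \<le> s"
      unfolding s_def t_def using x eta12 total_nonneg by (intro mult_right_mono powr_mono') auto
    have QQ: "AE \<sigma> in p. Q \<sigma> ** Q \<sigma> = 0 \<and> (\<forall>v. l (Q \<sigma> *v v) = of_real (e * \<beta> \<sigma> * Im (l v)))"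
      using zero(1)
    proof eventually_elim
      case (elim \<sigma>)
      have 1: "sl2 (Q \<sigma>)" using Psl2[of 1 \<sigma>] by (simp add: Q_def sl2_def flip: distrib_left)
      have 2: "pfun (Q \<sigma>) \<theta>hat = 0" "diag_coeff \<theta>hat (Q \<sigma>) = 0"
        "upper_coeff \<theta>hat (Q \<sigma>) = e * upper_coeff \<theta>hat (P 1 \<sigma>)"
        using elim linear_functionals(1,2)[of \<theta>hat, THEN bounded_linear.linear]
          linear_scale[OF bounded_linear.linear[OF linear_functionals(3)[of \<theta>hat]], of e "P 1 \<sigma>"]
        by (simp_all add: Q_def linear_scale)
      show ?case
        using nilpotent_square[OF 1 2(1,2)] frame_nilpotent[OF 1 2(1,2)]
        unfolding l_def by (simp add: 2(3) \<beta>_def mult_ac)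
    qed
    have EX: "norm (expectation X - e\<^sup>2 *\<^sub>R R) \<le> w"
    proof -
      \<comment> \<open>Among the indices below \<open>Kt\<close> only K has a nonzero mean, by the
        anomaly and by minimality of \<open>Kt\<close>. Owing to the shift it is summand K - 1, and
        the tail starts with the exponent of \<open>Kt\<close>.\<close>
      have "(\<Sum>k<Kt - 1. lam powr \<eta> (Suc k) *\<^sub>R expectation (P (Suc k)))
          = (\<Sum>k\<in>{K - 1}. lam powr \<eta> (Suc k) *\<^sub>R expectation (P (Suc k)))"
      proof (rule sum.mono_neutral_right)
        show "\<forall>i\<in>{..<Kt - 1} - {K - 1}. lam powr \<eta> (Suc i) *\<^sub>R expectation (P (Suc i)) = 0"
        proof
          fix i assume i: "i \<in> {..<Kt - 1} - {K - 1}"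
          then have "Suc i < K \<or> K < Suc i \<and> Suc i < Kt" using K1 by auto
          then have "expectation (P (Suc i)) = 0"
            using anomaly[of "Suc i"] EP0[of "Suc i"] by auto
          then show "lam powr \<eta> (Suc i) *\<^sub>R expectation (P (Suc i)) = 0" by simp
        qed
      qed (use Kt K1 in auto)
      also have "\<dots> = e\<^sup>2 *\<^sub>R R" using K1 by (simp add: e R_def)
      finally show ?thesis
        using norm_expectation_series_le[OF lam(1) lam'(1), of "Kt - 1"] Kt by (simp add: X_def w_def x_def)
    qed
    define S where "S = (\<lambda>\<sigma> v. mexp (X \<sigma>) *v v)"
    interpret dyn: random_dynamics p S
      by unfold_locales (simp add: S_def mexp_step_measurable)
    have gen: "norm (dyn.markov (direction l) v - direction l v - e\<^sup>2 *\<^sub>R D v) \<le> C0 * lam powr mn" for v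
    proof -
      have pw: "lam powr a \<le> lam powr mn" if "mn \<le> a" for a
        using lam lam'(2) that by (intro powr_mono') auto
      have st: "s * t \<le> total\<^sup>2 / lam0 powr (\<eta> 1 + \<eta> 2) * lam powr mn"
      proof -
        have "s * t = total\<^sup>2 / lam0 powr (\<eta> 1 + \<eta> 2) * lam powr (\<eta> 1 + \<eta> 2)"
          by (simp add: s_def t_def x_powr powr_add power2_eq_square)
        also have "\<dots> \<le> total\<^sup>2 / lam0 powr (\<eta> 1 + \<eta> 2) * lam powr mn"
          by (intro mult_left_mono pw) (auto simp: mn_def)
        finally show ?thesis .
      qed
      have s3: "s ^ 3 \<le> total ^ 3 / lam0 powr (3 * \<eta> 1) * lam powr mn"
      proof -
        have "(x powr \<eta> 1) ^ 3 = x powr (3 * \<eta> 1)"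
          using x by (simp add: powr_powr mult.commute flip: powr_realpow)
        then have "s ^ 3 = total ^ 3 / lam0 powr (3 * \<eta> 1) * lam powr (3 * \<eta> 1)"
          unfolding s_def power_mult_distrib by (simp add: x_powr)
        also have "\<dots> \<le> total ^ 3 / lam0 powr (3 * \<eta> 1) * lam powr mn"
          using eta2 total_nonneg by (intro mult_left_mono pw) (auto simp: mn_def)
        finally show ?thesis .
      qed
      have w: "w \<le> total / lam0 powr \<eta> Kt * lam powr mn"
      proof -
        have "w = total / lam0 powr \<eta> Kt * lam powr \<eta> Kt"
          by (simp add: w_def x_powr)
        also have "\<dots> \<le> total / lam0 powr \<eta> Kt * lam powr mn"
          using total_nonneg by (intro mult_left_mono pw) (auto simp: mn_def)
        finally show ?thesis .
      qed
      have "norm (dyn.markov (direction l) v - direction l v - e\<^sup>2 *\<^sub>R D v)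
          \<le> 300 * \<Lambda> ^ 3 * (s * t + s ^ 3) + 2 * \<Lambda> * w"
        unfolding dyn.markov_def unfolding S_def D_def
        by (rule expected_direction_step[OF lin \<Lambda>(2,1) X XQY QQ Qs Yt ts s \<beta> lR EX])
      also have "\<dots> \<le> 300 * \<Lambda> ^ 3 * (total\<^sup>2 / lam0 powr (\<eta> 1 + \<eta> 2) * lam powr mn
          + total ^ 3 / lam0 powr (3 * \<eta> 1) * lam powr mn) + 2 * \<Lambda> * (total / lam0 powr \<eta> Kt * lam powr mn)"
        using \<Lambda>(1) st s3 w by (intro add_mono mult_left_mono) auto
      also have "\<dots> = C0 * lam powr mn" by (simp add: C0_def algebra_simps)
      finally show ?thesis .
    qed
    have avgD: "norm (dyn.average (evec \<theta>0) N D) \<le> C0 * lam powr mn / e\<^sup>2 + 2 * 1 / (e\<^sup>2 * real N)"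
      by (rule dyn.average_generator[OF _ norm_direction_le D gen])
        (use e(1) N in \<open>auto intro: direction_measurable[OF lin]\<close>)
    \<comment> \<open>The two integrands agree for every \<omega>, so measurability of the angle
      orbit is not at issue.\<close>
    have "I_N p (\<lambda>\<sigma>. angle_map (M ** T lam \<sigma> ** matrix_inv M)) \<theta>0 N f = dyn.average (evec \<theta>0) N h"
    proof -
      have det0: "det (M ** T lam \<sigma> ** matrix_inv M) \<noteq> 0" for \<sigma>
      proof -
        have "invertible M" using detM by (simp add: invertible_det_nz)
        then have "M ** matrix_inv M = mat 1"
          unfolding invertible_def matrix_inv_def by (rule someI2_ex) simp
        then have "det M * det (matrix_inv M) = 1" by (metis det_I det_mul)
        then show ?thesis by (simp add: det_mul detT detM)
      qed
      have BX: "M ** T lam \<sigma> ** matrix_inv M = mexp (X \<sigma>) \<or> M ** T lam \<sigma> ** matrix_inv M = - mexp (X \<sigma>)" for \<sigma>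
        using expansion[OF lam(1) lam'(1), of \<sigma>] by (simp add: X_def series_def term_at_def)
      have "h (path S (evec \<theta>0) \<omega> n) = f (orbit (\<lambda>\<sigma>. angle_map (M ** T lam \<sigma> ** matrix_inv M)) \<theta>0 \<omega> n)" for \<omega> n
        unfolding S_def
        by (rule evec_orbit[of "\<lambda>\<sigma>. M ** T lam \<sigma> ** matrix_inv M" "\<lambda>\<sigma>. mexp (X \<sigma>)" \<theta>0 \<omega> n,
              OF BX det0])
          (rule h_evec)
      then show ?thesis by (simp add: I_N_def dyn.average_def)
    qed
    also have "\<bar>dyn.average (evec \<theta>0) N h - f \<theta>hat\<bar> \<le> (\<bar>c\<bar> + c') * norm (dyn.average (evec \<theta>0) N D)"
      by (rule dyn.average_dominated[OF h D dom N c(1)])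
    also have "\<dots> \<le> (\<bar>c\<bar> + c') * (C0 * lam powr mn / e\<^sup>2 + 2 * 1 / (e\<^sup>2 * real N))"
      using c(1) by (intro mult_left_mono avgD) auto
    also have "\<dots> = (\<bar>c\<bar> + c') * (C0 * lam powr (mn - \<eta> K) + 2 * (1 / (lam powr \<eta> K * real N)))"
      by (simp add: e powr_diff)
    also have "\<dots> \<le> (\<bar>c\<bar> + c') * ((C0 + 2) * lam powr (mn - \<eta> K) + (C0 + 2) * (1 / (lam powr \<eta> K * real N)))"
      using c(1) C0 by (intro mult_left_mono add_mono mult_right_mono) auto
    also have "\<dots> = C * (lam powr (mn - \<eta> K) + 1 / (lam powr \<eta> K * real N))"
      by (simp add: C_def distrib_left mult.assoc)
    finally show ?thesis .
  qed
  show ?thesis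
    using lam1 main unfolding mn_def Kt_def by blast
qed

end
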